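(* Let $\mathbf{L}_I=\{A : A+A^*\in\mathbf{P}\}$ and $\overline{\mathbf{L}}_I=\{A : A+A^*\in\overline{\mathbf{P}}\}$, where $A$ ranges over square complex matrices of all sizes. The following hold. (i) The set $\mathbf{L}_I$ is a cone, closed under inversion, contains the identity matrix $I$ (of every size), and is a maximal open matrix-convex set of non-singular matrices. (ii) Conversely, fix $n\ge 1$ and let $\mathcal{S}\subset\mathbb{C}^{n\times n}$ be a cone which is closed under inversion, contains $I_n$, is a maximal open convex set of non-singular matrices, and in addition is closed under unitary similarity (i.e. $U^*AU\in\mathcal{S}$ for all $A\in\mathcal{S}$ and all unitary $U\in\mathbb{C}^{n\times n}$). Then $\mathcal{S}=\{A\in\mathbb{C}^{n\times n} : A+A^*\in\mathbf{P}_n\}$, i.e. $\mathcal{S}$ is the set of $n\times n$ matrices in $\mathbf{L}_I$. (iii) The set $\overline{\mathbf{L}}_I$ is a cone, closed under inversion, and is a closed matrix-convex set containing the matrix $I$, and containing on its boundary the matrix $iI$. (iv) $\overline{\mathbf{L}}_I\cap\overline{\mathbf{L}}_{-I}=i\overline{\mathbf{H}}$, where $\overline{\mathbf{L}}_{-I}=\{A : -(A+A^* )\in\overline{\mathbf{P}}\}$. The set $i\overline{\mathbf{H}}$ is a matrix-convex cone, closed under inversion; in fact (for matrices of size $n\times n$), it is a maximal convex subset of $\mathbb{C}^{n\times n}$ which does not contain an involution.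
   Context: $\mathbf{P}_n$ (resp. $\overline{\mathbf{P}}_n$) is the set of $n\times n$ Hermitian positive definite (resp. positive semidefinite) complex matrices; $\overline{\mathbf{H}}_n$ is the set of all (possibly singular) $n\times n$ Hermitian matrices and $i\overline{\mathbf{H}}_n$ the set of $n\times n$ skew-Hermitian matrices. $\mathbf{P},\overline{\mathbf{P}},\overline{\mathbf{H}},i\overline{\mathbf{H}}$ without subscript denote the corresponding families over all sizes $n=1,2,\ldots$. A set of square matrices is a cone if it is closed under multiplication by positive scalars, and a convex cone if moreover it is closed under summation (of matrices of the same size). It is closed under inversion if whenever a matrix $M$ in it is non-singular, $M^{-1}$ is also in it. An involution is a matrix $E$ with $E^2=I$. A family $\mathbf{A}$ of square complex matrices (of various sizes) is matrix-convex if for all natural $\nu$ and $k$, all $A_1,\dots,A_k\in\mathbf{A}$ with $A_j$ of size $\eta_j\times\eta_j$, $1\le\eta_j\le\nu$, and all $\upsilon_j\in\mathbb{C}^{\eta_j\times\nu}$ with $\sum_{j=1}^k\upsilon_j^*\upsilon_j=I_\nu$, one has $\sum_{j=1}^k\upsilon_j^*A_j\upsilon_j\in\mathbf{A}$. It is a matrix-convex cone if the same holds whenever the condition $\sum_j\upsilon_j^*\upsilon_j=I_\nu$ is relaxed to $\sum_j\upsilon_j^*\upsilon_j\in\mathbf{P}_\nu$. For families of matrices of various sizes, topological notions (open, closed, closure, boundary) are understood in $\mathbb{C}^{n\times n}$ for each size $n$ separately. Maximality in (i) and (ii) is in the following sense: an open convex cone $\mathcal{S}$ of non-singular $n\times n$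 matrices is maximal if for every $B\in\mathbb{C}^{n\times n}$ not belonging to the closure of $\mathcal{S}$ there is $A\in\mathcal{S}$ such that $A+B$ is singular; for $\mathbf{L}_I$ in (i) this is required for each size $n$.
   Formalization: In (iv), maximality is proved among convex sets that are closed under inversion and contain no involution; among all convex sets without an involution the claim is false (for n=1 the strip 0 ≤ Re z < 1/2 is convex, involution-free and strictly larger than the imaginary axis). *)

theory Defs
  imports
    "Jordan_Normal_Form.Schur_Decomposition"
    "HOL-Analysis.Function_Topology"
begin

text \<open>
  Matrices are those of the session Jordan_Normal_Form, so that one family can contain matrices
  of several sizes. That library also has \<open>0 \<times> 0\<close> matrices; every family below starts at size 1.
\<close>

section \<open>Hermitian, positive (semi)definite and skew-Hermitian matrices\<close>

definition hermitian_mats :: "nat \<Rightarrow> complex mat set" where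
  "hermitian_mats n = {H \<in> carrier_mat n n. mat_adjoint H = H}"

text \<open>\<open>(H *\<^sub>v x) \<bullet>c x\<close> is \<open>x\<^sup>* H x\<close>, which is real for Hermitian \<open>H\<close>.\<close>

definition pd_mats :: "nat \<Rightarrow> complex mat set" where
  "pd_mats n = {H \<in> hermitian_mats n.
     \<forall>x \<in> carrier_vec n. x \<noteq> 0\<^sub>v n \<longrightarrow> 0 < Re ((H *\<^sub>v x) \<bullet>c x)}"

definition psd_mats :: "nat \<Rightarrow> complex mat set" where
  "psd_mats n = {H \<in> hermitian_mats n. \<forall>x \<in> carrier_vec n. 0 \<le> Re ((H *\<^sub>v x) \<bullet>c x)}"

definition skew_hermitian_mats :: "nat \<Rightarrow> complex mat set" where
  "skew_hermitian_mats n = {K \<in> carrier_mat n n. mat_adjoint K = - K}"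

definition all_sizes :: "(nat \<Rightarrow> complex mat set) \<Rightarrow> complex mat set" where
  "all_sizes F = (\<Union>n\<in>{1..}. F n)"

definition of_size :: "complex mat set \<Rightarrow> nat \<Rightarrow> complex mat set" where
  "of_size F n = F \<inter> carrier_mat n n"

definition unitary_mats :: "nat \<Rightarrow> complex mat set" where
  "unitary_mats n = {U \<in> carrier_mat n n. mat_adjoint U * U = 1\<^sub>m n}"

definition involution_mat :: "complex mat \<Rightarrow> bool" where
  "involution_mat E \<longleftrightarrow> square_mat E \<and> E * E = 1\<^sub>m (dim_row E)"

section \<open>The Lyapunov families\<close>

definition L_I :: "complex mat set" where
  "L_I = {A. square_mat A \<and> A + mat_adjoint A \<in> all_sizes pd_mats}"

definition L_I_bar :: "complex mat set" where
  "L_I_bar = {A. square_mat A \<and> A + mat_adjoint A \<in> all_sizes psd_mats}"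

definition L_minus_I_bar :: "complex mat set" where
  "L_minus_I_bar = {A. square_mat A \<and> - (A + mat_adjoint A) \<in> all_sizes psd_mats}"

section \<open>Cones, inversion, convexity\<close>

definition mat_cone :: "complex mat set \<Rightarrow> bool" where
  "mat_cone S \<longleftrightarrow> (\<forall>A\<in>S. square_mat A) \<and>
     (\<forall>A\<in>S. \<forall>r>0. complex_of_real r \<cdot>\<^sub>m A \<in> S)"

definition closed_under_inversion :: "complex mat set \<Rightarrow> bool" where
  "closed_under_inversion S \<longleftrightarrow>
     (\<forall>M\<in>S. \<forall>N. inverts_mat M N \<and> inverts_mat N M \<longrightarrow> N \<in> S)"

definition convex_mats :: "nat \<Rightarrow> complex mat set \<Rightarrow> bool" where
  "convex_mats n S \<longleftrightarrow> S \<subseteq> carrier_mat n n \<and>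
     (\<forall>A\<in>S. \<forall>B\<in>S. \<forall>t\<in>{0..1}.
        complex_of_real t \<cdot>\<^sub>m A + complex_of_real (1 - t) \<cdot>\<^sub>m B \<in> S)"

abbreviation mat_sum :: "nat \<Rightarrow> nat \<Rightarrow> (nat \<Rightarrow> complex mat) \<Rightarrow> complex mat" where
  "mat_sum n k f \<equiv> finsum (module_mat TYPE(complex) n n) f {..<k}"

text \<open>
  The conclusion of matrix-convexity, where \<open>P \<nu>\<close> is the set of admissible values of
  \<open>\<Sum>\<^sub>j \<upsilon>\<^sub>j\<^sup>* \<upsilon>\<^sub>j\<close>: the identity for matrix-convex families, all of \<open>pd_mats \<nu>\<close> for
  matrix-convex cones. The indices \<open>1, \<dots>, k\<close> are shifted to \<open>0, \<dots>, k - 1\<close>.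
\<close>

definition matrix_convex_wrt ::
    "(nat \<Rightarrow> complex mat set) \<Rightarrow> complex mat set \<Rightarrow> bool" where
  "matrix_convex_wrt P F \<longleftrightarrow> (\<forall>A\<in>F. square_mat A) \<and>
     (\<forall>\<nu> k. \<forall>\<eta> :: nat \<Rightarrow> nat. \<forall>A \<upsilon> :: nat \<Rightarrow> complex mat. 1 \<le> \<nu> \<longrightarrow>
        (\<forall>j<k. 1 \<le> \<eta> j \<and> \<eta> j \<le> \<nu> \<and> A j \<in> of_size F (\<eta> j) \<and> \<upsilon> j \<in> carrier_mat (\<eta> j) \<nu>) \<longrightarrow>
        mat_sum \<nu> k (\<lambda>j. mat_adjoint (\<upsilon> j) * \<upsilon> j) \<in> P \<nu> \<longrightarrow>
        mat_sum \<nu> k (\<lambda>j. mat_adjoint (\<upsilon> j) * A j * \<upsilon> j) \<in> F)"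

definition matrix_convex :: "complex mat set \<Rightarrow> bool" where
  "matrix_convex = matrix_convex_wrt (\<lambda>\<nu>. {1\<^sub>m \<nu>})"

definition matrix_convex_cone :: "complex mat set \<Rightarrow> bool" where
  "matrix_convex_cone = matrix_convex_wrt pd_mats"

section \<open>Topology and maximality\<close>

definition mat_topology :: "nat \<Rightarrow> complex mat topology" where
  "mat_topology n = pullback_topology (carrier_mat n n)
     (\<lambda>A. \<lambda>ij\<in>{..<n} \<times> {..<n}. A $$ ij)
     (product_topology (\<lambda>_. euclidean) ({..<n} \<times> {..<n}))"

definition maximal_nonsingular :: "nat \<Rightarrow> complex mat set \<Rightarrow> bool" where
  "maximal_nonsingular n S \<longleftrightarrow>
     (\<forall>B \<in> carrier_mat n n. B \<notin> mat_topology n closure_of S \<longrightarrow>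
        (\<exists>A\<in>S. \<not> invertible_mat (A + B)))"

definition maximal_open_matrix_convex_nonsingular :: "complex mat set \<Rightarrow> bool" where
  "maximal_open_matrix_convex_nonsingular F \<longleftrightarrow>
     matrix_convex F \<and> (\<forall>A\<in>F. invertible_mat A) \<and>
     (\<forall>n\<ge>1. openin (mat_topology n) (of_size F n)) \<and>
     (\<forall>n\<ge>1. maximal_nonsingular n (of_size F n))"

definition maximal_open_convex_nonsingular :: "nat \<Rightarrow> complex mat set \<Rightarrow> bool" where
  "maximal_open_convex_nonsingular n S \<longleftrightarrow>
     convex_mats n S \<and> (\<forall>A\<in>S. invertible_mat A) \<and>
     openin (mat_topology n) S \<and> maximal_nonsingular n S"

text \<open>
  Maximality with respect to inclusion among the convex sets that, like the set \<open>S\<close> under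
  consideration, are closed under inversion. Closure under inversion cannot be dropped for the
  competitors \<open>T\<close>: for \<open>n = 1\<close> the strip \<open>0 \<le> Re z < 1/2\<close> is convex, contains no involution
  and properly contains the imaginary axis (lemma \<open>skew_hermitian_not_maximal_convex\<close> below).
  Nor can it be traded for being a cone: for \<open>n = 2\<close> and \<open>H = diag(1, 0)\<close> the set of all
  \<open>r H + K\<close> with \<open>r \<ge> 0\<close> and \<open>K\<close> skew-Hermitian is a convex cone without involutions, since an
  involution has an integer trace \<open>r \<in> {0, 2}\<close> there, and \<open>r = 2\<close> would force it to be \<open>I\<close>.
\<close>

definition maximal_convex_without_involution :: "nat \<Rightarrow> complex mat set \<Rightarrow> bool" where
  "maximal_convex_without_involution n S \<longleftrightarrow>
     convex_mats n S \<and> (\<forall>A\<in>S. \<not> involution_mat A) \<and>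
     (\<forall>T. convex_mats n T \<longrightarrow> closed_under_inversion T \<longrightarrow>
        (\<forall>A\<in>T. \<not> involution_mat A) \<longrightarrow> S \<subseteq> T \<longrightarrow> T = S)"

lemma mat_sum_index:
  assumes "\<And>j. j < k \<Longrightarrow> f j \<in> carrier_mat n n"
  shows "mat_sum n k f \<in> carrier_mat n n \<and>
    (\<forall>a<n. \<forall>b<n. mat_sum n k f $$ (a, b) = (\<Sum>j<k. f j $$ (a, b)))"
  using assms
proof (induction k)
  case 0
  interpret abelian_group "module_mat TYPE(complex) n n"
    by (rule abelian_group_mat)
  show ?case by (simp add: module_mat_simps)
next
  case (Suc k)
  interpret abelian_group "module_mat TYPE(complex) n n"
    by (rule abelian_group_mat)
  have "mat_sum n (Suc k) f = f k + mat_sum n k f"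
    unfolding lessThan_Suc using Suc.prems
    by (subst finsum_insert) (auto simp: module_mat_simps)
  then show ?case using Suc by (auto simp: add.commute)
qed

lemma skew_hermitian_not_maximal_convex:
  "\<exists>T. convex_mats 1 T \<and> (\<forall>A\<in>T. \<not> involution_mat A) \<and> skew_hermitian_mats 1 \<subset> T"
proof -
  define T where "T = {A \<in> carrier_mat 1 1. 0 \<le> Re (A $$ (0,0)) \<and> Re (A $$ (0,0)) < 1/2}"
  have "convex_mats 1 T"
    unfolding convex_mats_def
  proof (intro conjI ballI)
    show "T \<subseteq> carrier_mat 1 1" by (auto simp: T_def)
    fix A B t assume A: "A \<in> T" and B: "B \<in> T" and t: "t \<in> {0..1::real}"
    let ?a = "Re (A $$ (0,0))" and ?b = "Re (B $$ (0,0))"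
    have "t * ?a + (1 - t) * ?b < 1/2"
      using A B t by (intro convex_bound_lt) (auto simp: T_def)
    moreover have "0 \<le> t * ?a + (1 - t) * ?b"
      using A B t by (auto simp: T_def)
    ultimately show "complex_of_real t \<cdot>\<^sub>m A + complex_of_real (1 - t) \<cdot>\<^sub>m B \<in> T"
      using A B by (auto simp: T_def)
  qed
  moreover have "\<not> involution_mat A" if "A \<in> T" for A
  proof
    assume "involution_mat A"
    then have "A * A = 1\<^sub>m 1" using that by (auto simp: involution_mat_def T_def)
    then have "(A * A) $$ (0,0) = 1" by simp
    then have "A $$ (0,0) * A $$ (0,0) = 1"
      using that by (auto simp: T_def scalar_prod_def times_mat_def row_def col_def)
    then have "(A $$ (0,0))\<^sup>2 = 1" by (simp add: power2_eq_square)
    then have "A $$ (0,0) = 1 \<or> A $$ (0,0) = -1" by (simp add: power2_eq_1_iff)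
    then show False using that by (auto simp: T_def)
  qed
  moreover have "skew_hermitian_mats 1 \<subseteq> T"
  proof
    fix K assume "K \<in> skew_hermitian_mats 1"
    then have K: "K \<in> carrier_mat 1 1" "mat_adjoint K = - K"
      by (auto simp: skew_hermitian_mats_def)
    then have "mat_adjoint K $$ (0,0) = - (K $$ (0,0))" by simp
    then have "cnj (K $$ (0,0)) = - (K $$ (0,0))"
      using K by (simp add: mat_adjoint_def mat_of_rows_def)
    then have "Re (K $$ (0,0)) = 0" by (simp add: complex_eq_iff)
    then show "K \<in> T" using K by (simp add: T_def)
  qed
  moreover have "(1/4) \<cdot>\<^sub>m 1\<^sub>m 1 \<in> T - skew_hermitian_mats 1"
  proof -
    let ?K = "(1/4) \<cdot>\<^sub>m 1\<^sub>m 1 :: complex mat"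
    have "mat_adjoint ?K $$ (0,0) \<noteq> (- ?K) $$ (0,0)"
      by (simp add: mat_adjoint_def mat_of_rows_def)
    then have "mat_adjoint ?K \<noteq> - ?K" by metis
    then show ?thesis by (auto simp: T_def skew_hermitian_mats_def)
  qed
  ultimately show ?thesis by blast
qed

end

theory Submission
  imports Defs "HOL-Analysis.Elementary_Metric_Spaces" "Jordan_Normal_Form.Spectral_Radius"
begin

text \<open>
  All families are described by the real form \<open>Re (x\<^sup>* A x)\<close>, which turns matrix convexity and
  closure under inversion into one-line computations.

  Maximality of \<open>L_I\<close>: if \<open>Re (x\<^sup>* B x) < 0\<close>, some \<open>A = r I + K\<close> with \<open>r > 0\<close> and \<open>K\<close>
  skew-Hermitian satisfies \<open>A x = - B x\<close>. For the converse, a reflection makes a given vector an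
  eigenvector of an averaged matrix, and a combination of that matrix, its inverse and \<open>I\<close>
  would be singular if the form were not positive.

  Let \<open>T\<close> be convex, closed under inversion, free of involutions, and contain the skew-Hermitian
  matrices. If \<open>A\<close> lies in \<open>T\<close> and has Hermitian part \<open>H\<close>, then \<open>t H + K\<close> lies in \<open>T\<close> for all
  \<open>0 < t < 1\<close> and all skew-Hermitian \<open>K\<close>. Diagonalizing \<open>H\<close>, one can choose \<open>K\<close> so that inversion
  moves a nonzero eigenvalue to a position with eigenvalue zero; once all eigenvalues are nonzero,
  another choice of \<open>K\<close> normalizes them to \<open>\<plusminus>1\<close>, which yields an involution unless \<open>H = 0\<close>.
\<close>

section \<open>The adjoint and the form \<open>Re (x\<^sup>* A x)\<close>\<close>

text \<open>For the competitor \<open>T\<close> the obstacle is that convexity with the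
  skew-Hermitian matrices only shrinks a Hermitian part. The skew-Hermitian part becomes free
  because these matrices form a real linear space: in \<open>t A + (1 - t) M\<close> the summand
  \<open>M\<close> cancels the skew-Hermitian part of \<open>A\<close> and installs any other one,
  which needs \<open>t < 1\<close>. Inversion is what lets Hermitian parts grow again. This explains
  the constant 2 in the last inversion: real parts \<open>\<plusminus>2\<close> are produced because
  a factor 1/2 is spent on removing the skew-Hermitian part of the inverse. Diagonal matrices alone
  do not suffice, since the inverse of an imaginary number is imaginary and an eigenvalue zero would
  stay zero; hence the coupling of two coordinates.

  In the converse about cones, unitary similarity enters because a value of the form at
  \<open>x\<close> says nothing about invertibility until \<open>x\<close> is an eigenvector.

  Openness asks for a lower bound uniform in \<open>x\<close>, not only for pointwise positivity. It
  is read off from the smallest eigenvalue, so the diagonalization serves both the open family and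
  the competitors \<open>T\<close>.\<close>

lemma dim_mat_adjoint [simp]:
  "dim_row (mat_adjoint A) = dim_col A" "dim_col (mat_adjoint A) = dim_row A"
  by (auto simp: mat_adjoint_def)

lemma mat_adjoint_carrier [simp, intro]:
  "A \<in> carrier_mat m n \<Longrightarrow> mat_adjoint A \<in> carrier_mat n m"
  by (intro carrier_matI) auto

lemma mat_adjoint_index [simp]:
  fixes A :: "complex mat"
  shows "i < dim_col A \<Longrightarrow> j < dim_row A \<Longrightarrow> mat_adjoint A $$ (i, j) = cnj (A $$ (j, i))"
  by (auto simp: mat_adjoint_def mat_of_rows_def)

lemma mat_adjoint_adjoint [simp]:
  fixes A :: "complex mat"
  shows "mat_adjoint (mat_adjoint A) = A"
  by (rule eq_matI) auto

lemma mat_adjoint_add: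
  fixes A :: "complex mat"
  assumes "A \<in> carrier_mat m n" "B \<in> carrier_mat m n"
  shows "mat_adjoint (A + B) = mat_adjoint A + mat_adjoint B"
  using assms by (intro eq_matI) auto

lemma mat_adjoint_one [simp]: "mat_adjoint (1\<^sub>m n :: complex mat) = 1\<^sub>m n"
  by (rule eq_matI) auto

lemma mat_adjoint_mult:
  fixes A :: "complex mat"
  assumes "A \<in> carrier_mat m n" "B \<in> carrier_mat n p"
  shows "mat_adjoint (A * B) = mat_adjoint B * mat_adjoint A"
  using assms by (intro eq_matI) (auto simp: scalar_prod_def mult.commute intro!: sum.cong)

section \<open>The complex inner product\<close>

lemma cscalar_prod_adjoint:
  fixes A :: "complex mat"
  assumes "A \<in> carrier_mat m n" "x \<in> carrier_vec n" "y \<in> carrier_vec m"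
  shows "(A *\<^sub>v x) \<bullet>c y = x \<bullet>c (mat_adjoint A *\<^sub>v y)"
proof -
  have "(A *\<^sub>v x) \<bullet>c y = (\<Sum>i<m. \<Sum>j<n. A $$ (i, j) * x $ j * cnj (y $ i))"
    using assms
    by (auto simp: scalar_prod_def sum_distrib_right atLeast0LessThan intro!: sum.cong)
  also have "\<dots> = (\<Sum>j<n. \<Sum>i<m. A $$ (i, j) * x $ j * cnj (y $ i))"
    by (rule sum.swap)
  also have "\<dots> = x \<bullet>c (mat_adjoint A *\<^sub>v y)"
    using assms
    by (auto simp: scalar_prod_def sum_distrib_left atLeast0LessThan mult_ac intro!: sum.cong)
  finally show ?thesis .
qed

lemma cscalar_prod_commute:
  fixes x :: "complex vec"
  assumes "x \<in> carrier_vec n" "y \<in> carrier_vec n"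
  shows "x \<bullet>c y = cnj (y \<bullet>c x)"
  using assms by (auto simp: scalar_prod_def mult.commute intro!: sum.cong)

lemma cscalar_prod_add_left:
  fixes x :: "complex vec"
  assumes "x \<in> carrier_vec n" "y \<in> carrier_vec n" "z \<in> carrier_vec n"
  shows "(x + y) \<bullet>c z = x \<bullet>c z + y \<bullet>c z"
  using assms by (intro add_scalar_prod_distrib) auto

lemma cscalar_prod_add_right:
  fixes x :: "complex vec"
  assumes "x \<in> carrier_vec n" "y \<in> carrier_vec n" "z \<in> carrier_vec n"
  shows "x \<bullet>c (y + z) = x \<bullet>c y + x \<bullet>c z"
  using assms by (simp add: conjugate_add_vec scalar_prod_add_distrib[of _ n])

lemma cscalar_prod_smult_left:
  fixes x :: "complex vec"
  assumes "x \<in> carrier_vec n" "y \<in> carrier_vec n"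
  shows "(c \<cdot>\<^sub>v x) \<bullet>c y = c * (x \<bullet>c y)"
  using assms by simp

lemma cscalar_prod_self:
  fixes x :: "complex vec"
  shows "x \<bullet>c x = of_real (\<Sum>i<dim_vec x. (cmod (x $ i))\<^sup>2)"
  by (auto simp: scalar_prod_def atLeast0LessThan complex_norm_square simp del: of_real_power)

lemma Re_cscalar_prod_self:
  fixes x :: "complex vec"
  shows "Re (x \<bullet>c x) = (\<Sum>i<dim_vec x. (cmod (x $ i))\<^sup>2)"
  unfolding cscalar_prod_self by (rule Re_complex_of_real)

lemma Re_cscalar_prod_self_nonneg [simp]:
  fixes x :: "complex vec"
  shows "0 \<le> Re (x \<bullet>c x)"
  unfolding Re_cscalar_prod_self by (intro sum_nonneg) auto

lemma Re_cscalar_prod_self_pos: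
  fixes x :: "complex vec"
  assumes "x \<in> carrier_vec n" "x \<noteq> 0\<^sub>v n"
  shows "0 < Re (x \<bullet>c x)"
proof -
  have "Re (x \<bullet>c x) \<noteq> 0"
  proof
    assume "Re (x \<bullet>c x) = 0"
    then have "x \<bullet>c x = 0" by (simp add: cscalar_prod_self Re_cscalar_prod_self)
    then show False using assms by simp
  qed
  then show ?thesis using Re_cscalar_prod_self_nonneg[of x] by linarith
qed

text \<open>Taking the real part discards the skew-Hermitian part of \<open>A\<close>, so this
  quantity depends on the Hermitian part alone and is additive in \<open>A\<close>.\<close>

abbreviation re_form :: "complex mat \<Rightarrow> complex vec \<Rightarrow> real" where
  "re_form A x \<equiv> Re ((A *\<^sub>v x) \<bullet>c x)"

lemma re_form_add:
  assumes "A \<in> carrier_mat n n" "B \<in> carrier_mat n n" "x \<in> carrier_vec n"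
  shows "re_form (A + B) x = re_form A x + re_form B x"
  using assms by (simp add: add_mult_distrib_mat_vec[of _ n n] cscalar_prod_add_left[of _ n])

lemma smult_mat_mult_vec:
  fixes A :: "complex mat"
  assumes "A \<in> carrier_mat m n" "x \<in> carrier_vec n"
  shows "(c \<cdot>\<^sub>m A) *\<^sub>v x = c \<cdot>\<^sub>v (A *\<^sub>v x)"
  using assms by (intro eq_vecI) (auto simp: scalar_prod_def sum_distrib_left mult.assoc)

lemma re_form_smult:
  assumes "A \<in> carrier_mat n n" "x \<in> carrier_vec n"
  shows "re_form (complex_of_real r \<cdot>\<^sub>m A) x = r * re_form A x"
  using assms by (simp add: smult_mat_mult_vec cscalar_prod_smult_left[of _ n])

lemma re_form_uminus:
  assumes "A \<in> carrier_mat n n" "x \<in> carrier_vec n"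
  shows "re_form (- A) x = - re_form A x"
proof -
  have "- A = complex_of_real (-1) \<cdot>\<^sub>m A"
    by (rule eq_matI) auto
  then show ?thesis using re_form_smult[OF assms, of "-1"] by simp
qed

lemma re_form_one:
  "x \<in> carrier_vec n \<Longrightarrow> re_form (1\<^sub>m n) x = Re (x \<bullet>c x)"
  by simp

lemma re_form_adjoint:
  assumes "A \<in> carrier_mat n n" "x \<in> carrier_vec n"
  shows "re_form (mat_adjoint A) x = re_form A x"
proof -
  have "(mat_adjoint A *\<^sub>v x) \<bullet>c x = x \<bullet>c (A *\<^sub>v x)"
    using assms by (subst cscalar_prod_adjoint[of _ n n]) auto
  also have "\<dots> = cnj ((A *\<^sub>v x) \<bullet>c x)"
    using assms by (intro cscalar_prod_commute[of _ n]) auto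
  finally show ?thesis by simp
qed

text \<open>The left factor moves across the inner product. \<open>V\<close> may be rectangular, as
  matrix convexity requires.\<close>

lemma re_form_congruence:
  assumes "A \<in> carrier_mat m m" "V \<in> carrier_mat m n" "x \<in> carrier_vec n"
  shows "re_form (mat_adjoint V * A * V) x = re_form A (V *\<^sub>v x)"
proof -
  have V: "V *\<^sub>v x \<in> carrier_vec m" using assms by auto
  have "(mat_adjoint V * A * V) *\<^sub>v x = mat_adjoint V *\<^sub>v (A *\<^sub>v (V *\<^sub>v x))"
    using assoc_mult_mat_vec[of "mat_adjoint V * A" n m V n x]
      assoc_mult_mat_vec[of "mat_adjoint V" n m A m "V *\<^sub>v x"]
      mult_carrier_mat[of "mat_adjoint V" n m A m] assms V by auto
  then show ?thesis
    using assms V by (simp add: cscalar_prod_adjoint[of _ n m])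
qed

lemma re_form_add_adjoint:
  assumes "A \<in> carrier_mat n n" "x \<in> carrier_vec n"
  shows "re_form (A + mat_adjoint A) x = 2 * re_form A x"
  using assms by (simp add: re_form_add[of _ n] re_form_adjoint)

lemma add_adjoint_hermitian:
  "A \<in> carrier_mat n n \<Longrightarrow> A + mat_adjoint A \<in> hermitian_mats n"
  by (auto simp: hermitian_mats_def mat_adjoint_add[of _ n n] intro!: comm_add_mat[of _ n n])

text \<open>Expanding the form at \<open>x + H x\<close> leaves twice the squared norm of
  \<open>H x\<close>, because both cross terms equal that norm. So \<open>H\<close> kills every
  vector.\<close>

lemma hermitian_form_zero:
  assumes H: "H \<in> hermitian_mats n" and z: "\<And>x. x \<in> carrier_vec n \<Longrightarrow> re_form H x = 0"
  shows "H = 0\<^sub>m n n"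
proof -
  have Hc: "H \<in> carrier_mat n n" and Ha: "mat_adjoint H = H"
    using H by (auto simp: hermitian_mats_def)
  have Hx: "H *\<^sub>v x = 0\<^sub>v n" if x: "x \<in> carrier_vec n" for x
  proof -
    let ?y = "H *\<^sub>v x"
    have y: "?y \<in> carrier_vec n" "H *\<^sub>v ?y \<in> carrier_vec n" using Hc x by auto
    have "(H *\<^sub>v ?y) \<bullet>c x = ?y \<bullet>c ?y"
      using cscalar_prod_adjoint[OF Hc y(1) x] Ha by simp
    moreover have "re_form H (x + ?y)
        = re_form H x + Re (?y \<bullet>c ?y) + Re ((H *\<^sub>v ?y) \<bullet>c x) + re_form H ?y"
      using Hc x y
      by (simp add: mult_add_distrib_mat_vec[OF Hc] cscalar_prod_add_left[of _ n]
          cscalar_prod_add_right[of _ n])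
    ultimately have "Re (?y \<bullet>c ?y) = 0"
      using z[OF x] z[OF y(1)] z[of "x + ?y"] x y by simp
    then show ?thesis
      using Re_cscalar_prod_self_pos[OF y(1)] by force
  qed
  show ?thesis
  proof (rule eq_matI)
    fix i j assume "i < dim_row (0\<^sub>m n n)" "j < dim_col (0\<^sub>m n n)"
    then have ij: "i < n" "j < n" by auto
    have "H $$ (i, j) = (H *\<^sub>v unit_vec n j) $ i"
      using Hc ij by auto
    then show "H $$ (i, j) = 0\<^sub>m n n $$ (i, j)" using Hx[of "unit_vec n j"] ij by simp
  qed (use Hc in auto)
qed

section \<open>Descriptions of the families by their forms\<close>

text \<open>The dimensions of \<open>A\<close> determine the only index at which it can occur in the
  union.\<close>

lemma all_sizes_carrier_iff:
  assumes A: "A \<in> carrier_mat n n" and F: "\<And>m. F m \<subseteq> carrier_mat m m"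
  shows "A \<in> all_sizes F \<longleftrightarrow> 1 \<le> n \<and> A \<in> F n"
proof
  assume "A \<in> all_sizes F"
  then obtain m where m: "A \<in> F m" "1 \<le> m" by (auto simp: all_sizes_def)
  then have "A \<in> carrier_mat m m" using F by blast
  then have "m = n" using A by auto
  then show "1 \<le> n \<and> A \<in> F n" using m by simp
next
  assume "1 \<le> n \<and> A \<in> F n"
  then show "A \<in> all_sizes F" by (auto simp: all_sizes_def)
qed

lemma add_adjoint_pd_iff:
  assumes "A \<in> carrier_mat n n"
  shows "A + mat_adjoint A \<in> pd_mats n \<longleftrightarrow>
    (\<forall>x\<in>carrier_vec n. x \<noteq> 0\<^sub>v n \<longrightarrow> 0 < re_form A x)"
  using assms by (auto simp: pd_mats_def add_adjoint_hermitian re_form_add_adjoint)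

lemma add_adjoint_psd_iff:
  assumes "A \<in> carrier_mat n n"
  shows "A + mat_adjoint A \<in> psd_mats n \<longleftrightarrow> (\<forall>x\<in>carrier_vec n. 0 \<le> re_form A x)"
  using assms by (auto simp: psd_mats_def add_adjoint_hermitian re_form_add_adjoint)

lemma pd_psd_carrier: "pd_mats n \<subseteq> carrier_mat n n" "psd_mats n \<subseteq> carrier_mat n n"
  by (auto simp: pd_mats_def psd_mats_def hermitian_mats_def)

lemma square_matE:
  assumes "square_mat A"
  obtains n where "A \<in> carrier_mat n n"
  using assms that[of "dim_row A"] by auto

lemma L_I_iff:
  assumes A: "A \<in> carrier_mat n n"
  shows "A \<in> L_I \<longleftrightarrow> 1 \<le> n \<and> (\<forall>x\<in>carrier_vec n. x \<noteq> 0\<^sub>v n \<longrightarrow> 0 < re_form A x)"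
proof -
  have "A + mat_adjoint A \<in> carrier_mat n n" "square_mat A" using A by auto
  then show ?thesis
    by (simp add: L_I_def all_sizes_carrier_iff pd_psd_carrier add_adjoint_pd_iff[OF A])
qed

lemma L_I_bar_iff:
  assumes A: "A \<in> carrier_mat n n"
  shows "A \<in> L_I_bar \<longleftrightarrow> 1 \<le> n \<and> (\<forall>x\<in>carrier_vec n. 0 \<le> re_form A x)"
proof -
  have "A + mat_adjoint A \<in> carrier_mat n n" "square_mat A" using A by auto
  then show ?thesis
    by (simp add: L_I_bar_def all_sizes_carrier_iff pd_psd_carrier add_adjoint_psd_iff[OF A])
qed

lemma L_minus_I_bar_iff_uminus:
  assumes "square_mat A"
  shows "A \<in> L_minus_I_bar \<longleftrightarrow> - A \<in> L_I_bar"
proof -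
  from assms obtain n where A: "A \<in> carrier_mat n n" by (rule square_matE)
  have "- (A + mat_adjoint A) = - A + mat_adjoint (- A)"
    using A by (intro eq_matI) auto
  then show ?thesis using assms by (auto simp: L_minus_I_bar_def L_I_bar_def)
qed

text \<open>In the converse direction \<open>K + mat_adjoint K\<close> is Hermitian with vanishing
  form, hence zero.\<close>

lemma skew_hermitian_iff:
  assumes K: "K \<in> carrier_mat n n"
  shows "K \<in> skew_hermitian_mats n \<longleftrightarrow> (\<forall>x\<in>carrier_vec n. re_form K x = 0)"
proof
  assume "K \<in> skew_hermitian_mats n"
  then have "mat_adjoint K = - K" by (auto simp: skew_hermitian_mats_def)
  then have "re_form K x = - re_form K x" if "x \<in> carrier_vec n" for x
    using re_form_adjoint[OF K that] re_form_uminus[OF K that] by simp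
  then show "\<forall>x\<in>carrier_vec n. re_form K x = 0" by force
next
  assume z: "\<forall>x\<in>carrier_vec n. re_form K x = 0"
  have "K + mat_adjoint K = 0\<^sub>m n n"
    using z K by (intro hermitian_form_zero add_adjoint_hermitian) (auto simp: re_form_add_adjoint)
  then have e: "(K + mat_adjoint K) $$ (i, j) = 0" if "i < n" "j < n" for i j
    using that by simp
  have "mat_adjoint K = - K"
  proof (rule eq_matI)
    fix i j assume "i < dim_row (- K)" "j < dim_col (- K)"
    then show "mat_adjoint K $$ (i, j) = (- K) $$ (i, j)"
      using e[of i j] K by (simp add: eq_neg_iff_add_eq_0 add.commute)
  qed (use K in auto)
  then show "K \<in> skew_hermitian_mats n" using K by (simp add: skew_hermitian_mats_def)
qed

lemma skew_hermitian_all_sizes_iff: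
  assumes "K \<in> carrier_mat n n"
  shows "K \<in> all_sizes skew_hermitian_mats \<longleftrightarrow>
    1 \<le> n \<and> (\<forall>x\<in>carrier_vec n. re_form K x = 0)"
proof -
  have "skew_hermitian_mats m \<subseteq> carrier_mat m m" for m by (auto simp: skew_hermitian_mats_def)
  then show ?thesis
    using assms by (simp add: all_sizes_carrier_iff skew_hermitian_iff)
qed

lemma family_square_mat:
  "A \<in> L_I \<Longrightarrow> square_mat A"
  "A \<in> L_I_bar \<Longrightarrow> square_mat A"
  "A \<in> all_sizes skew_hermitian_mats \<Longrightarrow> square_mat A"
  by (auto simp: L_I_def L_I_bar_def all_sizes_def skew_hermitian_mats_def)

section \<open>Matrix convexity and inversion\<close>

lemma mat_sum_Suc:
  assumes "\<And>j. j < Suc k \<Longrightarrow> f j \<in> carrier_mat n n"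
  shows "mat_sum n (Suc k) f = f k + mat_sum n k f"
proof -
  interpret abelian_group "module_mat TYPE(complex) n n"
    by (rule abelian_group_mat)
  show ?thesis
    unfolding lessThan_Suc using assms
    by (subst finsum_insert) (auto simp: module_mat_simps)
qed

lemma mat_sum_carrier:
  "(\<And>j. j < k \<Longrightarrow> f j \<in> carrier_mat n n) \<Longrightarrow> mat_sum n k f \<in> carrier_mat n n"
  using mat_sum_index by blast

lemma re_form_mat_sum:
  assumes "\<And>j. j < k \<Longrightarrow> f j \<in> carrier_mat n n" "x \<in> carrier_vec n"
  shows "re_form (mat_sum n k f) x = (\<Sum>j<k. re_form (f j) x)"
  using assms(1)
proof (induction k)
  case 0
  have "mat_sum n 0 f = 0\<^sub>m n n"
    using mat_sum_index[of 0 f n] by (intro eq_matI) auto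
  moreover have "0\<^sub>m n n *\<^sub>v x = 0\<^sub>v n" using assms(2) by (intro eq_vecI) auto
  ultimately show ?case using assms(2) by simp
next
  case (Suc k)
  then show ?case
    using mat_sum_carrier[of k f n] assms(2)
    by (subst mat_sum_Suc) (auto simp: re_form_add[of _ n])
qed

lemma re_form_mat_sum_congruence:
  assumes "\<And>j. j < k \<Longrightarrow> A j \<in> carrier_mat (\<eta> j) (\<eta> j)"
    and "\<And>j. j < k \<Longrightarrow> V j \<in> carrier_mat (\<eta> j) n" and "x \<in> carrier_vec n"
  shows "re_form (mat_sum n k (\<lambda>j. mat_adjoint (V j) * A j * V j)) x
    = (\<Sum>j<k. re_form (A j) (V j *\<^sub>v x))"
proof -
  have "mat_adjoint (V j) * A j * V j \<in> carrier_mat n n" if "j < k" for j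
    using assms(1,2)[OF that] by auto
  then have "re_form (mat_sum n k (\<lambda>j. mat_adjoint (V j) * A j * V j)) x
      = (\<Sum>j<k. re_form (mat_adjoint (V j) * A j * V j) x)"
    using assms(3) by (rule re_form_mat_sum)
  also have "\<dots> = (\<Sum>j<k. re_form (A j) (V j *\<^sub>v x))"
    using assms by (intro sum.cong refl re_form_congruence) auto
  finally show ?thesis .
qed

text \<open>Through this identity the normalization of the coefficients becomes a statement about
  norms: if the Gram sum is the identity, the squared norms of the \<open>V j *\<^sub>v x\<close>
  add up to that of \<open>x\<close>.\<close>

lemma re_form_mat_sum_gram:
  assumes V: "\<And>j. j < k \<Longrightarrow> V j \<in> carrier_mat (\<eta> j) n" and x: "x \<in> carrier_vec n"
  shows "re_form (mat_sum n k (\<lambda>j. mat_adjoint (V j) * V j)) x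
    = (\<Sum>j<k. Re ((V j *\<^sub>v x) \<bullet>c (V j *\<^sub>v x)))"
proof -
  have c: "mat_adjoint (V j) * V j \<in> carrier_mat n n" if "j < k" for j
    using V[OF that] by auto
  have "re_form (mat_sum n k (\<lambda>j. mat_adjoint (V j) * V j)) x
      = (\<Sum>j<k. re_form (mat_adjoint (V j) * V j) x)"
    using c x by (rule re_form_mat_sum)
  also have "\<dots> = (\<Sum>j<k. Re ((V j *\<^sub>v x) \<bullet>c (V j *\<^sub>v x)))"
  proof (intro sum.cong refl)
    fix j assume "j \<in> {..<k}"
    then have Vj: "V j \<in> carrier_mat (\<eta> j) n" using V by auto
    then have "mat_adjoint (V j) * V j = mat_adjoint (V j) * 1\<^sub>m (\<eta> j) * V j"
      by (simp add: right_mult_one_mat[of _ n])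
    then show "re_form (mat_adjoint (V j) * V j) x = Re ((V j *\<^sub>v x) \<bullet>c (V j *\<^sub>v x))"
      using re_form_congruence[OF one_carrier_mat Vj x] Vj x by simp
  qed
  finally show ?thesis .
qed

lemma mat_sum_congruence_carrier:
  assumes "\<And>j. j < k \<Longrightarrow> A j \<in> carrier_mat (\<eta> j) (\<eta> j)"
    and "\<And>j. j < k \<Longrightarrow> V j \<in> carrier_mat (\<eta> j) n"
  shows "mat_sum n k (\<lambda>j. mat_adjoint (V j) * A j * V j) \<in> carrier_mat n n"
  using assms by (intro mat_sum_carrier) (auto intro!: mult_carrier_mat)

text \<open>All summands of the form are nonnegative; strictness needs one nonzero
  \<open>V j *\<^sub>v x\<close>. It exists because the squared norms of these vectors add up to
  that of \<open>x\<close>.\<close>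

lemma matrix_convex_L_I: "matrix_convex L_I"
  unfolding matrix_convex_def matrix_convex_wrt_def
proof (intro conjI allI impI ballI)
  show "square_mat A" if "A \<in> L_I" for A using that by (rule family_square_mat)
  fix \<nu> k :: nat and \<eta> :: "nat \<Rightarrow> nat" and A V :: "nat \<Rightarrow> complex mat"
  assume \<nu>: "1 \<le> \<nu>" and
    h: "\<forall>j<k. 1 \<le> \<eta> j \<and> \<eta> j \<le> \<nu> \<and> A j \<in> of_size L_I (\<eta> j) \<and> V j \<in> carrier_mat (\<eta> j) \<nu>" and
    one: "mat_sum \<nu> k (\<lambda>j. mat_adjoint (V j) * V j) \<in> {1\<^sub>m \<nu>}"
  have A: "A j \<in> carrier_mat (\<eta> j) (\<eta> j)" and V: "V j \<in> carrier_mat (\<eta> j) \<nu>"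
    and pos: "\<And>x. x \<in> carrier_vec (\<eta> j) \<Longrightarrow> x \<noteq> 0\<^sub>v (\<eta> j) \<Longrightarrow> 0 < re_form (A j) x"
    if "j < k" for j
    using h that by (auto simp: of_size_def L_I_iff[of _ "\<eta> j"])
  have nonneg: "0 \<le> re_form (A j) x" if "j < k" "x \<in> carrier_vec (\<eta> j)" for j x
    using pos[OF that] A[OF that(1)] by (cases "x = 0\<^sub>v (\<eta> j)") auto
  let ?M = "mat_sum \<nu> k (\<lambda>j. mat_adjoint (V j) * A j * V j)"
  have M: "?M \<in> carrier_mat \<nu> \<nu>" using A V by (rule mat_sum_congruence_carrier)
  have "0 < re_form ?M x" if x: "x \<in> carrier_vec \<nu>" "x \<noteq> 0\<^sub>v \<nu>" for x
  proof -
    have "(\<Sum>j<k. Re ((V j *\<^sub>v x) \<bullet>c (V j *\<^sub>v x))) = Re (x \<bullet>c x)"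
      using re_form_mat_sum_gram[of k V \<eta> \<nu> x] V one x(1) by simp
    then have "(\<Sum>j<k. Re ((V j *\<^sub>v x) \<bullet>c (V j *\<^sub>v x))) \<noteq> 0"
      using Re_cscalar_prod_self_pos[OF x] by simp
    then obtain j where j: "j < k" and "Re ((V j *\<^sub>v x) \<bullet>c (V j *\<^sub>v x)) \<noteq> 0"
      by (meson lessThan_iff sum.neutral)
    then have "V j *\<^sub>v x \<noteq> 0\<^sub>v (\<eta> j)" by auto
    then have "0 < re_form (A j) (V j *\<^sub>v x)" using pos[OF j] V[OF j] x by auto
    then have "0 < (\<Sum>j<k. re_form (A j) (V j *\<^sub>v x))"
      using j x by (intro sum_pos2[of _ j] nonneg mult_mat_vec_carrier[OF V]) auto
    then show ?thesis
      using re_form_mat_sum_congruence[of k A \<eta> V \<nu> x] A V x(1) by simp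
  qed
  then show "?M \<in> L_I" using \<nu> by (simp add: L_I_iff[OF M])
qed

lemma matrix_convex_L_I_bar: "matrix_convex L_I_bar"
  unfolding matrix_convex_def matrix_convex_wrt_def
proof (intro conjI allI impI ballI)
  show "square_mat A" if "A \<in> L_I_bar" for A using that by (rule family_square_mat)
  fix \<nu> k :: nat and \<eta> :: "nat \<Rightarrow> nat" and A V :: "nat \<Rightarrow> complex mat"
  assume \<nu>: "1 \<le> \<nu>" and
    h: "\<forall>j<k. 1 \<le> \<eta> j \<and> \<eta> j \<le> \<nu> \<and> A j \<in> of_size L_I_bar (\<eta> j) \<and> V j \<in> carrier_mat (\<eta> j) \<nu>"
  have A: "A j \<in> carrier_mat (\<eta> j) (\<eta> j)" and V: "V j \<in> carrier_mat (\<eta> j) \<nu>"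
    and nonneg: "\<And>x. x \<in> carrier_vec (\<eta> j) \<Longrightarrow> 0 \<le> re_form (A j) x"
    if "j < k" for j
    using h that by (auto simp: of_size_def L_I_bar_iff[of _ "\<eta> j"])
  let ?M = "mat_sum \<nu> k (\<lambda>j. mat_adjoint (V j) * A j * V j)"
  have M: "?M \<in> carrier_mat \<nu> \<nu>" using A V by (rule mat_sum_congruence_carrier)
  have "0 \<le> re_form ?M x" if x: "x \<in> carrier_vec \<nu>" for x
  proof -
    have "re_form ?M x = (\<Sum>j<k. re_form (A j) (V j *\<^sub>v x))"
      using A V x by (rule re_form_mat_sum_congruence)
    also have "\<dots> \<ge> 0"
      using x by (intro sum_nonneg nonneg mult_mat_vec_carrier[OF V]) auto
    finally show ?thesis .
  qed
  then show "?M \<in> L_I_bar" using \<nu> by (simp add: L_I_bar_iff[OF M])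
qed

lemma matrix_convex_cone_skew_hermitian: "matrix_convex_cone (all_sizes skew_hermitian_mats)"
  unfolding matrix_convex_cone_def matrix_convex_wrt_def
proof (intro conjI allI impI ballI)
  show "square_mat A" if "A \<in> all_sizes skew_hermitian_mats" for A
    using that by (rule family_square_mat)
  fix \<nu> k :: nat and \<eta> :: "nat \<Rightarrow> nat" and A V :: "nat \<Rightarrow> complex mat"
  assume \<nu>: "1 \<le> \<nu>" and
    h: "\<forall>j<k. 1 \<le> \<eta> j \<and> \<eta> j \<le> \<nu> \<and> A j \<in> of_size (all_sizes skew_hermitian_mats) (\<eta> j)
      \<and> V j \<in> carrier_mat (\<eta> j) \<nu>"
  have A: "A j \<in> carrier_mat (\<eta> j) (\<eta> j)" and V: "V j \<in> carrier_mat (\<eta> j) \<nu>"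
    and zero: "\<And>x. x \<in> carrier_vec (\<eta> j) \<Longrightarrow> re_form (A j) x = 0"
    if "j < k" for j
    using h that by (auto simp: of_size_def skew_hermitian_all_sizes_iff[of _ "\<eta> j"])
  let ?M = "mat_sum \<nu> k (\<lambda>j. mat_adjoint (V j) * A j * V j)"
  have M: "?M \<in> carrier_mat \<nu> \<nu>" using A V by (rule mat_sum_congruence_carrier)
  have "re_form ?M x = 0" if x: "x \<in> carrier_vec \<nu>" for x
  proof -
    have "re_form ?M x = (\<Sum>j<k. re_form (A j) (V j *\<^sub>v x))"
      using A V x by (rule re_form_mat_sum_congruence)
    also have "\<dots> = 0"
      using x by (intro sum.neutral ballI zero mult_mat_vec_carrier[OF V]) auto
    finally show ?thesis .
  qed
  then show "?M \<in> all_sizes skew_hermitian_mats"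
    using \<nu> by (simp add: skew_hermitian_all_sizes_iff[OF M])
qed

text \<open>\<open>inverts_mat\<close> compares a product with an identity sized by its left factor,
  so the shape of \<open>N\<close> has to be recovered from both products together.\<close>

lemma inverts_mat_carrier:
  fixes M N :: "complex mat"
  assumes "M \<in> carrier_mat n n" "inverts_mat M N" "inverts_mat N M"
  shows "N \<in> carrier_mat n n" "M * N = 1\<^sub>m n" "N * M = 1\<^sub>m n"
proof -
  show MN: "M * N = 1\<^sub>m n" using assms by (simp add: inverts_mat_def)
  have "dim_col N = n" using arg_cong[OF MN, of dim_col] by simp
  moreover have NM: "N * M = 1\<^sub>m (dim_row N)" using assms by (simp add: inverts_mat_def)
  then have "dim_row N = n" using assms(1) by (metis carrier_matD(2) index_mult_mat(3) index_one_mat(3))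
  ultimately show "N \<in> carrier_mat n n" "N * M = 1\<^sub>m n" using NM by auto
qed

text \<open>With \<open>y = N *\<^sub>v x\<close> one has \<open>x = M *\<^sub>v y\<close>; swapping
  the two arguments of the inner product only conjugates its value. Every sign condition on the form
  therefore passes to the inverse.\<close>

lemma re_form_inverse:
  assumes M: "M \<in> carrier_mat n n" and N: "N \<in> carrier_mat n n" and MN: "M * N = 1\<^sub>m n"
    and x: "x \<in> carrier_vec n"
  shows "re_form N x = re_form M (N *\<^sub>v x)"
proof -
  have y: "N *\<^sub>v x \<in> carrier_vec n" using N x by auto
  have "M *\<^sub>v (N *\<^sub>v x) = x"
    using assms by (simp flip: assoc_mult_mat_vec[OF M N x])
  then have "re_form M (N *\<^sub>v x) = Re (x \<bullet>c (N *\<^sub>v x))" by simp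
  also have "\<dots> = re_form N x" using cscalar_prod_commute[OF x y] by simp
  finally show ?thesis ..
qed

lemma inverse_mult_vec_nonzero:
  fixes M N :: "complex mat"
  assumes M: "M \<in> carrier_mat n n" and N: "N \<in> carrier_mat n n" and MN: "M * N = 1\<^sub>m n"
    and x: "x \<in> carrier_vec n" "x \<noteq> 0\<^sub>v n"
  shows "N *\<^sub>v x \<noteq> 0\<^sub>v n"
proof
  assume "N *\<^sub>v x = 0\<^sub>v n"
  then have "M *\<^sub>v (N *\<^sub>v x) = 0\<^sub>v n" using M by auto
  moreover have "M *\<^sub>v (N *\<^sub>v x) = x"
    using assms by (simp flip: assoc_mult_mat_vec[OF M N x(1)])
  ultimately show False using x by simp
qed

lemma closed_under_inversion_L_I: "closed_under_inversion L_I"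
  unfolding closed_under_inversion_def
proof (intro ballI allI impI)
  fix M N assume M: "M \<in> L_I" and inv: "inverts_mat M N \<and> inverts_mat N M"
  from M obtain n where Mc: "M \<in> carrier_mat n n"
    by (blast elim: square_matE dest: family_square_mat)
  have n: "1 \<le> n"
    and pos: "\<And>x. x \<in> carrier_vec n \<Longrightarrow> x \<noteq> 0\<^sub>v n \<Longrightarrow> 0 < re_form M x"
    using M by (auto simp: L_I_iff[OF Mc])
  note N = inverts_mat_carrier[OF Mc conjunct1[OF inv] conjunct2[OF inv]]
  have "0 < re_form N x" if "x \<in> carrier_vec n" "x \<noteq> 0\<^sub>v n" for x
    unfolding re_form_inverse[OF Mc N(1,2) that(1)]
    using N that by (intro pos inverse_mult_vec_nonzero[OF Mc]) auto
  then show "N \<in> L_I" using n by (simp add: L_I_iff[OF N(1)])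
qed

lemma closed_under_inversion_L_I_bar: "closed_under_inversion L_I_bar"
  unfolding closed_under_inversion_def
proof (intro ballI allI impI)
  fix M N assume M: "M \<in> L_I_bar" and inv: "inverts_mat M N \<and> inverts_mat N M"
  from M obtain n where Mc: "M \<in> carrier_mat n n"
    by (blast elim: square_matE dest: family_square_mat)
  have n: "1 \<le> n"
    and nonneg: "\<And>x. x \<in> carrier_vec n \<Longrightarrow> 0 \<le> re_form M x"
    using M by (auto simp: L_I_bar_iff[OF Mc])
  note N = inverts_mat_carrier[OF Mc conjunct1[OF inv] conjunct2[OF inv]]
  have "0 \<le> re_form N x" if "x \<in> carrier_vec n" for x
    unfolding re_form_inverse[OF Mc N(1,2) that]
    using N that by (intro nonneg) auto
  then show "N \<in> L_I_bar" using n by (simp add: L_I_bar_iff[OF N(1)])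
qed

lemma closed_under_inversion_skew_hermitian:
  "closed_under_inversion (all_sizes skew_hermitian_mats)"
  unfolding closed_under_inversion_def
proof (intro ballI allI impI)
  fix M N assume M: "M \<in> all_sizes skew_hermitian_mats"
    and inv: "inverts_mat M N \<and> inverts_mat N M"
  from M obtain n where Mc: "M \<in> carrier_mat n n"
    by (blast elim: square_matE dest: family_square_mat)
  have n: "1 \<le> n"
    and zero: "\<And>x. x \<in> carrier_vec n \<Longrightarrow> re_form M x = 0"
    using M by (auto simp: skew_hermitian_all_sizes_iff[OF Mc])
  note N = inverts_mat_carrier[OF Mc conjunct1[OF inv] conjunct2[OF inv]]
  have "re_form N x = 0" if "x \<in> carrier_vec n" for x
    unfolding re_form_inverse[OF Mc N(1,2) that]
    using N that by (intro zero) auto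
  then show "N \<in> all_sizes skew_hermitian_mats"
    using n by (simp add: skew_hermitian_all_sizes_iff[OF N(1)])
qed

section \<open>Positive multiples, and the intersection with the opposite family\<close>

lemma mat_cone_L_I: "mat_cone L_I"
  unfolding mat_cone_def
proof (intro conjI ballI allI impI)
  show "square_mat A" if "A \<in> L_I" for A using that by (rule family_square_mat)
  show "complex_of_real r \<cdot>\<^sub>m A \<in> L_I" if "A \<in> L_I" "0 < r" for A r
  proof -
    obtain n where A: "A \<in> carrier_mat n n"
      using \<open>A \<in> L_I\<close> by (blast elim: square_matE dest: family_square_mat)
    then have "complex_of_real r \<cdot>\<^sub>m A \<in> carrier_mat n n" by simp
    then show ?thesis
      using that by (simp add: L_I_iff[of _ n] A re_form_smult[OF A])
  qed
qed

lemma mat_cone_L_I_bar: "mat_cone L_I_bar"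
  unfolding mat_cone_def
proof (intro conjI ballI allI impI)
  show "square_mat A" if "A \<in> L_I_bar" for A using that by (rule family_square_mat)
  show "complex_of_real r \<cdot>\<^sub>m A \<in> L_I_bar" if "A \<in> L_I_bar" "0 < r" for A r
  proof -
    obtain n where A: "A \<in> carrier_mat n n"
      using \<open>A \<in> L_I_bar\<close> by (blast elim: square_matE dest: family_square_mat)
    then have "complex_of_real r \<cdot>\<^sub>m A \<in> carrier_mat n n" by simp
    then show ?thesis
      using that by (simp add: L_I_bar_iff[of _ n] A re_form_smult[OF A])
  qed
qed

lemma L_I_bar_inter_L_minus_I_bar: "L_I_bar \<inter> L_minus_I_bar = all_sizes skew_hermitian_mats"
  unfolding set_eq_iff
proof
  fix A :: "complex mat"
  show "A \<in> L_I_bar \<inter> L_minus_I_bar \<longleftrightarrow> A \<in> all_sizes skew_hermitian_mats"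
  proof (cases "square_mat A")
    case True
    then obtain n where A: "A \<in> carrier_mat n n" by (rule square_matE)
    then have "- A \<in> carrier_mat n n" by simp
    then show ?thesis
      using L_minus_I_bar_iff_uminus[OF True] re_form_uminus[OF A]
      by (auto simp: L_I_bar_iff[of _ n] A skew_hermitian_all_sizes_iff[OF A] intro: antisym)
  next
    case False
    then show ?thesis using family_square_mat by blast
  qed
qed

section \<open>The topology in terms of entries\<close>

text \<open>These are the balls of the entrywise maximum distance. They stand in for the pullback of
  the product topology in all estimates.\<close>

definition entries_near :: "nat \<Rightarrow> real \<Rightarrow> complex mat \<Rightarrow> complex mat \<Rightarrow> bool" where
  "entries_near n e A B \<longleftrightarrow> (\<forall>i<n. \<forall>j<n. cmod (B $$ (i, j) - A $$ (i, j)) < e)"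

lemma topspace_mat_topology [simp]: "topspace (mat_topology n) = carrier_mat n n"
  by (auto simp: mat_topology_def topspace_pullback_topology)

lemma openin_mat_topology_imp_near:
  assumes U: "openin (mat_topology n) U" and A: "A \<in> U"
  obtains e where "0 < e" "\<And>B. B \<in> carrier_mat n n \<Longrightarrow> entries_near n e A B \<Longrightarrow> B \<in> U"
proof -
  let ?I = "{..<n} \<times> {..<n}" and ?f = "\<lambda>A :: complex mat. \<lambda>ij\<in>{..<n} \<times> {..<n}. A $$ ij"
  obtain V where V: "openin (product_topology (\<lambda>_. euclidean) ?I) V"
    and UV: "U = ?f -` V \<inter> carrier_mat n n"
    using U by (auto simp: mat_topology_def openin_pullback_topology)
  then have "?f A \<in> V" using A by auto
  then obtain W where W: "\<forall>p\<in>?I. open (W p)" "?f A \<in> Pi\<^sub>E ?I W" "Pi\<^sub>E ?I W \<subseteq> V"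
    using V by (auto simp: openin_product_topology_alt)
  have "\<exists>e>0. ball (A $$ p) e \<subseteq> W p" if "p \<in> ?I" for p
  proof -
    have "A $$ p \<in> W p" using W(2) that by (auto simp: PiE_iff)
    then show ?thesis using W(1) that open_contains_ball by blast
  qed
  then obtain e where e: "\<And>p. p \<in> ?I \<Longrightarrow> 0 < e p \<and> ball (A $$ p) (e p) \<subseteq> W p" by metis
  \<comment> \<open>Finitely many entries allow one common radius; the inserted 1 keeps the set
    nonempty when \<open>n = 0\<close>.\<close>
  define d where "d = Min (insert 1 (e ` ?I))"
  have "0 < d" unfolding d_def using e by (subst Min_gr_iff) auto
  moreover have "B \<in> U" if B: "B \<in> carrier_mat n n" "entries_near n d A B" for B
  proof -
    have "B $$ p \<in> W p" if p: "p \<in> ?I" for p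
    proof -
      have "d \<le> e p" unfolding d_def using p by (intro Min_le) auto
      moreover have "cmod (B $$ p - A $$ p) < d"
        using B(2) p by (auto simp: entries_near_def)
      ultimately have "B $$ p \<in> ball (A $$ p) (e p)" by (simp add: dist_norm norm_minus_commute)
      then show ?thesis using e[OF p] by auto
    qed
    then have "?f B \<in> Pi\<^sub>E ?I W" by auto
    then have "?f B \<in> V" using W(3) by (rule rev_subsetD)
    then show ?thesis using UV B(1) by simp
  qed
  ultimately show ?thesis using that by blast
qed

lemma openin_mat_topologyI:
  assumes U: "U \<subseteq> carrier_mat n n"
    and near: "\<And>A. A \<in> U \<Longrightarrow> \<exists>e>0. \<forall>B\<in>carrier_mat n n. entries_near n e A B \<longrightarrow> B \<in> U"
  shows "openin (mat_topology n) U"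
proof -
  let ?I = "{..<n} \<times> {..<n}" and ?f = "\<lambda>A :: complex mat. \<lambda>ij\<in>{..<n} \<times> {..<n}. A $$ ij"
  have inv: "mat n n (?f A) = A" if "A \<in> carrier_mat n n" for A
    using that by (intro eq_matI) auto
  \<comment> \<open>\<open>mat n n\<close> undoes the entry map on the carrier, so this set of
    extensional functions has exactly \<open>U\<close> as its preimage.\<close>
  define V where "V = {g \<in> extensional ?I. mat n n g \<in> U}"
  have "openin (product_topology (\<lambda>_. euclidean) ?I) V"
    unfolding openin_product_topology_alt
  proof (intro ballI)
    fix g assume g: "g \<in> V"
    then obtain e where e: "e > 0"
      "\<And>B. B \<in> carrier_mat n n \<Longrightarrow> entries_near n e (mat n n g) B \<Longrightarrow> B \<in> U"
      using near[of "mat n n g"] by (auto simp: V_def)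
    have "Pi\<^sub>E ?I (\<lambda>p. ball (g p) e) \<subseteq> V"
    proof
      fix h assume h: "h \<in> Pi\<^sub>E ?I (\<lambda>p. ball (g p) e)"
      have "cmod (h (i, j) - g (i, j)) < e" if "i < n" "j < n" for i j
      proof -
        have "h (i, j) \<in> ball (g (i, j)) e" using h that by (auto simp: PiE_iff)
        then show ?thesis by (simp add: dist_norm norm_minus_commute)
      qed
      then have "entries_near n e (mat n n g) (mat n n h)"
        by (auto simp: entries_near_def)
      then show "h \<in> V" using e(2)[of "mat n n h"] h by (auto simp: V_def PiE_iff)
    qed
    then show "\<exists>W. finite {i \<in> ?I. W i \<noteq> topspace euclidean} \<and>
        (\<forall>i\<in>?I. openin euclidean (W i)) \<and> g \<in> Pi\<^sub>E ?I W \<and> Pi\<^sub>E ?I W \<subseteq> V"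
      using e(1) g by (intro exI[of _ "\<lambda>p. ball (g p) e"]) (auto simp: V_def PiE_iff)
  qed
  moreover have "U = ?f -` V \<inter> carrier_mat n n"
    using U inv by (auto simp: V_def)
  ultimately show ?thesis
    unfolding mat_topology_def openin_pullback_topology by blast
qed

lemma entries_near_refl: "0 < e \<Longrightarrow> entries_near n e A A"
  by (simp add: entries_near_def)

text \<open>Openness of the balls themselves is what allows membership in a closure to be tested on
  them alone.\<close>

lemma openin_entries_near:
  "openin (mat_topology n) {B \<in> carrier_mat n n. entries_near n e A B}"
proof (rule openin_mat_topologyI)
  fix B assume "B \<in> {B \<in> carrier_mat n n. entries_near n e A B}"
  then have B: "\<And>i j. i < n \<Longrightarrow> j < n \<Longrightarrow> cmod (B $$ (i, j) - A $$ (i, j)) < e"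
    by (auto simp: entries_near_def)
  define d where "d = Min (insert 1 ((\<lambda>(i, j). e - cmod (B $$ (i, j) - A $$ (i, j))) ` ({..<n} \<times> {..<n})))"
  have "0 < d" unfolding d_def using B by (subst Min_gr_iff) auto
  moreover have "entries_near n e A C" if C: "entries_near n d B C" for C
    unfolding entries_near_def
  proof (intro allI impI)
    fix i j assume ij: "i < n" "j < n"
    have "d \<le> e - cmod (B $$ (i, j) - A $$ (i, j))"
      unfolding d_def using ij by (intro Min_le) force+
    moreover have "cmod (C $$ (i, j) - B $$ (i, j)) < d" using C ij by (simp add: entries_near_def)
    moreover have "cmod (C $$ (i, j) - A $$ (i, j))
        \<le> cmod (C $$ (i, j) - B $$ (i, j)) + cmod (B $$ (i, j) - A $$ (i, j))"
      using norm_triangle_ineq[of "C $$ (i, j) - B $$ (i, j)" "B $$ (i, j) - A $$ (i, j)"] by simp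
    ultimately show "cmod (C $$ (i, j) - A $$ (i, j)) < e" by linarith
  qed
  ultimately show "\<exists>d>0. \<forall>C\<in>carrier_mat n n. entries_near n d B C \<longrightarrow>
      C \<in> {B \<in> carrier_mat n n. entries_near n e A B}" by auto
qed auto

lemma in_closure_of_mat_topology:
  "B \<in> mat_topology n closure_of S \<longleftrightarrow> B \<in> carrier_mat n n \<and>
    (\<forall>e>0. \<exists>A\<in>S \<inter> carrier_mat n n. entries_near n e B A)"
proof
  assume B: "B \<in> mat_topology n closure_of S"
  then have Bc: "B \<in> carrier_mat n n" by (simp add: in_closure_of)
  have "\<exists>A\<in>S \<inter> carrier_mat n n. entries_near n e B A" if "e > 0" for e
  proof -
    let ?T = "{A \<in> carrier_mat n n. entries_near n e B A}"
    have "B \<in> ?T" using Bc that entries_near_refl by simp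
    moreover have "\<forall>T. B \<in> T \<and> openin (mat_topology n) T \<longrightarrow> (\<exists>y. y \<in> S \<and> y \<in> T)"
      using B by (simp add: in_closure_of)
    ultimately have "\<exists>y. y \<in> S \<and> y \<in> ?T"
      using openin_entries_near[of n e B] by (metis (no_types, lifting))
    then show ?thesis by auto
  qed
  then show "B \<in> carrier_mat n n \<and> (\<forall>e>0. \<exists>A\<in>S \<inter> carrier_mat n n. entries_near n e B A)"
    using Bc by blast
next
  assume h: "B \<in> carrier_mat n n \<and> (\<forall>e>0. \<exists>A\<in>S \<inter> carrier_mat n n. entries_near n e B A)"
  show "B \<in> mat_topology n closure_of S"
    unfolding in_closure_of
  proof (intro conjI allI impI)
    show "B \<in> topspace (mat_topology n)" using h by simp
    fix T assume "B \<in> T \<and> openin (mat_topology n) T"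
    then obtain e where "e > 0" "\<And>C. C \<in> carrier_mat n n \<Longrightarrow> entries_near n e B C \<Longrightarrow> C \<in> T"
      using openin_mat_topology_imp_near by metis
    then show "\<exists>y. y \<in> S \<and> y \<in> T" using h by blast
  qed
qed

text \<open>Each entry of the difference contributes at most \<open>e\<close> times
  \<open>cmod (x $ j) * cmod (x $ i)\<close>, which is at most the mean of the two squares. Summed
  over all index pairs, these means give \<open>n\<close> times the squared norm of
  \<open>x\<close>.\<close>

lemma re_form_near:
  assumes A: "A \<in> carrier_mat n n" and B: "B \<in> carrier_mat n n" and x: "x \<in> carrier_vec n"
    and near: "entries_near n e A B"
  shows "\<bar>re_form B x - re_form A x\<bar> \<le> e * n * Re (x \<bullet>c x)"
proof -
  define a where "a i = cmod (x $ i)" for i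
  have form: "(C *\<^sub>v x) \<bullet>c x = (\<Sum>i<n. \<Sum>j<n. C $$ (i, j) * x $ j * cnj (x $ i))"
    if "C \<in> carrier_mat n n" for C
    using that x
    by (auto simp: scalar_prod_def sum_distrib_right atLeast0LessThan intro!: sum.cong)
  have "\<bar>re_form B x - re_form A x\<bar> \<le> cmod ((B *\<^sub>v x) \<bullet>c x - (A *\<^sub>v x) \<bullet>c x)"
    using abs_Re_le_cmod[of "(B *\<^sub>v x) \<bullet>c x - (A *\<^sub>v x) \<bullet>c x"] by simp
  also have "(B *\<^sub>v x) \<bullet>c x - (A *\<^sub>v x) \<bullet>c x
      = (\<Sum>i<n. \<Sum>j<n. (B $$ (i, j) - A $$ (i, j)) * (x $ j * cnj (x $ i)))"
    unfolding form[OF A] form[OF B] by (simp add: algebra_simps flip: sum_subtractf)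
  also have "cmod \<dots> \<le> (\<Sum>i<n. \<Sum>j<n. e * ((a j)\<^sup>2 + (a i)\<^sup>2) / 2)"
  proof (intro sum_norm_le)
    fix i j assume ij: "i \<in> {..<n}" "j \<in> {..<n}"
    have "cmod (B $$ (i, j) - A $$ (i, j)) < e" using near ij by (simp add: entries_near_def)
    moreover from this have "0 \<le> e" using norm_ge_zero[of "B $$ (i, j) - A $$ (i, j)"] by linarith
    moreover have "a j * a i \<le> ((a j)\<^sup>2 + (a i)\<^sup>2) / 2"
      using sum_squares_ge_zero[of "a j - a i" 0] by (simp add: power2_eq_square algebra_simps)
    ultimately have "cmod (B $$ (i, j) - A $$ (i, j)) * (a j * a i) \<le> e * (((a j)\<^sup>2 + (a i)\<^sup>2) / 2)"
      by (intro mult_mono) (auto simp: a_def)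
    then show "cmod ((B $$ (i, j) - A $$ (i, j)) * (x $ j * cnj (x $ i)))
        \<le> e * ((a j)\<^sup>2 + (a i)\<^sup>2) / 2"
      by (simp add: norm_mult a_def)
  qed
  also have "\<dots> = e * n * (\<Sum>i<n. (a i)\<^sup>2)"
  proof -
    define b where "b i = (a i)\<^sup>2" for i
    have "(\<Sum>i<n. \<Sum>j<n. e * (b j + b i) / 2)
        = (\<Sum>i<n. \<Sum>j<n. e / 2 * b j) + (\<Sum>i<n. \<Sum>j<n. e / 2 * b i)"
      by (simp add: distrib_left add_divide_distrib flip: sum.distrib)
    also have "(\<Sum>i<n. \<Sum>j<n. e / 2 * b j) = n * (e / 2 * (\<Sum>i<n. b i))"
      unfolding sum_distrib_left [symmetric] by simp
    also have "(\<Sum>i<n. \<Sum>j<n. e / 2 * b i) = n * (e / 2 * (\<Sum>i<n. b i))"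
      by (simp add: sum_distrib_left)
    finally show ?thesis by (simp add: b_def)
  qed
  also have "(\<Sum>i<n. (a i)\<^sup>2) = Re (x \<bullet>c x)"
    using x by (simp add: Re_cscalar_prod_self a_def)
  finally show ?thesis .
qed

section \<open>Unitary diagonalization of Hermitian matrices\<close>

lemma unitary_matsD:
  assumes "U \<in> unitary_mats n"
  shows "U \<in> carrier_mat n n" "mat_adjoint U * U = 1\<^sub>m n" "U * mat_adjoint U = 1\<^sub>m n"
proof -
  show U: "U \<in> carrier_mat n n" "mat_adjoint U * U = 1\<^sub>m n"
    using assms by (auto simp: unitary_mats_def)
  show "U * mat_adjoint U = 1\<^sub>m n"
    by (rule mat_mult_left_right_inverse[OF _ U(1) U(2)]) (use U in auto)
qed

lemma mult_mat_cancel_mid: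
  fixes A :: "complex mat"
  assumes "A \<in> carrier_mat n n" "B \<in> carrier_mat n n" "C \<in> carrier_mat n n" "D \<in> carrier_mat n n"
    and "B * C = 1\<^sub>m n"
  shows "A * B * (C * D) = A * D"
proof -
  have CD: "C * D \<in> carrier_mat n n" using assms by auto
  have "A * B * (C * D) = A * (B * (C * D))"
    by (rule assoc_mult_mat[OF assms(1,2) CD])
  also have "B * (C * D) = B * C * D"
    by (rule assoc_mult_mat[OF assms(2-4), symmetric])
  finally show ?thesis using assms by simp
qed

lemma unitary_mats_mult:
  assumes U: "U \<in> unitary_mats n" and V: "V \<in> unitary_mats n"
  shows "U * V \<in> unitary_mats n"
proof -
  note u = unitary_matsD[OF U] and v = unitary_matsD[OF V]
  have "mat_adjoint (U * V) * (U * V) = mat_adjoint V * mat_adjoint U * (U * V)"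
    using u v by (simp add: mat_adjoint_mult[of _ n n _ n])
  also have "\<dots> = mat_adjoint V * V"
    using u v by (intro mult_mat_cancel_mid) auto
  finally show ?thesis using u v by (auto simp: unitary_mats_def)
qed

lemma hermitian_congruence:
  assumes "H \<in> hermitian_mats n" "V \<in> carrier_mat n m"
  shows "mat_adjoint V * H * V \<in> hermitian_mats m"
proof -
  have H: "H \<in> carrier_mat n n" "mat_adjoint H = H"
    using assms by (auto simp: hermitian_mats_def)
  have VH: "mat_adjoint V * H \<in> carrier_mat m n" using assms H by auto
  have "mat_adjoint (mat_adjoint V * H * V) = mat_adjoint V * (H * V)"
    using assms H VH
    by (simp add: mat_adjoint_mult[OF VH assms(2)] mat_adjoint_mult[of _ m n _ n])
  also have "\<dots> = mat_adjoint V * H * V"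
    using assms H by (intro assoc_mult_mat[symmetric]) auto
  finally show ?thesis using assms H VH by (auto simp: hermitian_mats_def)
qed

text \<open>Complete \<open>v\<close> to a basis and orthogonalize. Gram-Schmidt keeps the first
  vector, and the final normalization is the reason for the scalar \<open>c\<close>.\<close>

lemma unitary_with_first_column:
  fixes v :: "complex vec"
  assumes v: "v \<in> carrier_vec n" "v \<noteq> 0\<^sub>v n"
  obtains U c where "U \<in> unitary_mats n" "col U 0 = c \<cdot>\<^sub>v v"
proof -
  interpret cof_vec_space n "TYPE(complex)" .
  have n: "0 < n" using v by (cases n) auto
  define b where "b = basis_completion v"
  note bc = basis_completion[OF v, folded b_def]
  define ws where "ws = gram_schmidt n b"
  have ws: "set ws \<subseteq> carrier_vec n" "corthogonal ws" "length ws = n"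
    using gram_schmidt_result[OF bc(2,4,5) ws_def] bc(6) by auto
  obtain vs where "b = v # vs" using bc(6,7) n by (cases b) auto
  then have "hd ws = v" using gram_schmidt_hd[OF v(1), of vs] by (simp add: ws_def)
  then have ws0: "ws ! 0 = v" using ws(3) n by (cases ws) auto
  \<comment> \<open>The reciprocal norm of the vector with index \<open>j\<close>; being real, it
    passes through conjugation unchanged.\<close>
  define a where "a j = complex_of_real (1 / sqrt (Re (ws ! j \<bullet>c ws ! j)))" for j
  have cnj_a [simp]: "cnj (a j) = a j" for j by (simp add: a_def)
  define U where "U = mat n n (\<lambda>(i, j). a j * (ws ! j) $ i)"
  have wsc: "ws ! j \<in> carrier_vec n" if "j < n" for j using ws that by auto
  have "mat_adjoint U * U = 1\<^sub>m n"
  proof (rule eq_matI)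
    fix i j assume "i < dim_row (1\<^sub>m n)" "j < dim_col (1\<^sub>m n)"
    then have ij: "i < n" "j < n" by auto
    have "(mat_adjoint U * U) $$ (i, j) = (\<Sum>k<n. cnj (a i * (ws ! i) $ k) * (a j * (ws ! j) $ k))"
      using ij by (auto simp: U_def scalar_prod_def atLeast0LessThan intro!: sum.cong)
    also have "\<dots> = a i * a j * (ws ! j \<bullet>c ws ! i)"
      using wsc[OF ij(1)] wsc[OF ij(2)] ij
      by (auto simp: scalar_prod_def sum_distrib_left atLeast0LessThan mult_ac intro!: sum.cong)
    also have "\<dots> = 1\<^sub>m n $$ (i, j)"
    proof (cases "i = j")
      case True
      have "ws ! i \<bullet>c ws ! i \<noteq> 0" using corthogonalD[OF ws(2)] ws(3) ij by auto
      then have pos: "0 < Re (ws ! i \<bullet>c ws ! i)"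
        using Re_cscalar_prod_self_pos[OF wsc[OF ij(1)]] wsc[OF ij(1)] by auto
      have "ws ! i \<bullet>c ws ! i = complex_of_real (Re (ws ! i \<bullet>c ws ! i))"
        unfolding cscalar_prod_self Re_complex_of_real ..
      then have "a i * a i * (ws ! i \<bullet>c ws ! i)
          = complex_of_real (1 / sqrt (Re (ws ! i \<bullet>c ws ! i)) * (1 / sqrt (Re (ws ! i \<bullet>c ws ! i)))
              * Re (ws ! i \<bullet>c ws ! i))"
        unfolding a_def of_real_mult by simp
      also have "\<dots> = 1" using pos by (simp add: field_simps)
      finally show ?thesis using True ij by simp
    next
      case False
      then have "ws ! j \<bullet>c ws ! i = 0" using corthogonalD[OF ws(2), of j i] ws(3) ij by auto
      then show ?thesis using False ij by simp
    qed
    finally show "(mat_adjoint U * U) $$ (i, j) = 1\<^sub>m n $$ (i, j)" .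
  qed (auto simp: U_def)
  then have "U \<in> unitary_mats n" by (auto simp: unitary_mats_def U_def)
  moreover have "col U 0 = a 0 \<cdot>\<^sub>v v"
    using n v ws0 by (intro eq_vecI) (auto simp: U_def)
  ultimately show ?thesis by (rule that)
qed

lemma hermitian_eigenvector:
  fixes H :: "complex mat"
  assumes "H \<in> carrier_mat n n" "0 < n"
  obtains k v where "v \<in> carrier_vec n" "v \<noteq> 0\<^sub>v n" "H *\<^sub>v v = k \<cdot>\<^sub>v v"
  using spectrum_non_empty[OF assms] assms
  by (auto simp: spectrum_def eigenvalue_def eigenvector_def)

text \<open>Deflation: a unitary matrix whose first column is an eigenvector reduces the first
  column of \<open>H\<close> to a multiple of the first unit vector. Hermitian symmetry clears the
  first row as well, so a Hermitian block one size smaller remains.\<close>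

theorem hermitian_diagonalization:
  assumes "H \<in> hermitian_mats n"
  obtains U d where "U \<in> unitary_mats n"
    "mat_adjoint U * H * U = mat_diag n (\<lambda>i. complex_of_real (d i))"
proof -
  have "\<exists>U\<in>unitary_mats n. \<exists>d. mat_adjoint U * H * U = mat_diag n (\<lambda>i. complex_of_real (d i))"
    using assms
  proof (induction n arbitrary: H)
    case 0
    then have "H \<in> carrier_mat 0 0" by (auto simp: hermitian_mats_def)
    then show ?case
      by (intro bexI[of _ "1\<^sub>m 0"]) (auto simp: unitary_mats_def mat_diag_def intro!: exI eq_matI)
  next
    case (Suc n)
    have H: "H \<in> carrier_mat (Suc n) (Suc n)" using Suc.prems by (auto simp: hermitian_mats_def)
    obtain k v where v: "v \<in> carrier_vec (Suc n)" "v \<noteq> 0\<^sub>v (Suc n)" "H *\<^sub>v v = k \<cdot>\<^sub>v v"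
      using hermitian_eigenvector[OF H zero_less_Suc] .
    obtain W c where W: "W \<in> unitary_mats (Suc n)" and W0: "col W 0 = c \<cdot>\<^sub>v v"
      using unitary_with_first_column[OF v(1,2)] by blast
    note Wu = unitary_matsD[OF W]
    define G where "G = mat_adjoint W * H * W"
    have Gh: "G \<in> hermitian_mats (Suc n)"
      unfolding G_def using Suc.prems Wu(1) by (rule hermitian_congruence)
    then have Gc: "G \<in> carrier_mat (Suc n) (Suc n)" by (auto simp: hermitian_mats_def)
    have Gsym: "G $$ (j, i) = cnj (G $$ (i, j))" if "i < Suc n" "j < Suc n" for i j
    proof -
      have "mat_adjoint G = G" using Gh by (simp add: hermitian_mats_def)
      then have "G $$ (j, i) = mat_adjoint G $$ (j, i)" by simp
      also have "\<dots> = cnj (G $$ (i, j))" using that Gc by simp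
      finally show ?thesis .
    qed
    have "col G 0 = k \<cdot>\<^sub>v unit_vec (Suc n) 0"
    proof -
      have W0c: "col W 0 \<in> carrier_vec (Suc n)" using W0 v(1) by simp
      have HW0: "H *\<^sub>v col W 0 = k \<cdot>\<^sub>v col W 0"
        using H v(1,3) W0 by (simp add: mult_mat_vec smult_smult_assoc mult.commute)
      have "col G 0 = (mat_adjoint W * H) *\<^sub>v col W 0"
        unfolding G_def using Wu H by (intro col_mult2[of _ "Suc n" "Suc n" _ "Suc n"]) auto
      also have "\<dots> = mat_adjoint W *\<^sub>v (H *\<^sub>v col W 0)"
        using Wu H W0c by (intro assoc_mult_mat_vec) auto
      also have "\<dots> = k \<cdot>\<^sub>v (mat_adjoint W *\<^sub>v col W 0)"
        unfolding HW0 using Wu W0c by (intro mult_mat_vec[of _ "Suc n" "Suc n"]) auto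
      also have "mat_adjoint W *\<^sub>v col W 0 = col (mat_adjoint W * W) 0"
        using Wu(1) by (intro col_mult2[symmetric, of _ "Suc n" "Suc n" _ "Suc n"]) auto
      also have "\<dots> = unit_vec (Suc n) 0" unfolding Wu(2) by simp
      finally show ?thesis .
    qed
    then have G0: "G $$ (i, 0) = (if i = 0 then k else 0)" if "i < Suc n" for i
      using Gc that by (metis (no_types, lifting) carrier_matD index_col index_smult_vec(1)
          index_unit_vec(1,3) mult.right_neutral mult_zero_right zero_less_Suc)
    \<comment> \<open>The eigenvalue is now a diagonal entry of a Hermitian matrix, hence
      real.\<close>
    have k: "k = complex_of_real (Re k)"
      using Gsym[of 0 0] G0[of 0] by (simp add: complex_eq_iff)
    define G' where "G' = mat n n (\<lambda>(i, j). G $$ (Suc i, Suc j))"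
    have "mat_adjoint G' = G'"
    proof (rule eq_matI)
      fix i j assume "i < dim_row G'" "j < dim_col G'"
      then show "mat_adjoint G' $$ (i, j) = G' $$ (i, j)"
        using Gsym[of "Suc j" "Suc i"] by (simp add: G'_def)
    qed (auto simp: G'_def)
    then have "G' \<in> hermitian_mats n" by (simp add: hermitian_mats_def G'_def)
    then obtain U d where U: "U \<in> unitary_mats n"
      and d: "mat_adjoint U * G' * U = mat_diag n (\<lambda>i. complex_of_real (d i))"
      using Suc.IH by blast
    note Uu = unitary_matsD[OF U]
    \<comment> \<open>The direct sum of a scalar and an \<open>n\<close>-dimensional block; such
      matrices multiply componentwise, which lifts the diagonalization of the block to the full
      size.\<close>
    let ?B = "\<lambda>a X. four_block_mat (a \<cdot>\<^sub>m 1\<^sub>m 1) (0\<^sub>m 1 n) (0\<^sub>m n 1) X :: complex mat"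
    have Bmult: "?B a X * ?B b Y = ?B (a * b) (X * Y)"
      if "X \<in> carrier_mat n n" "Y \<in> carrier_mat n n" for a b X Y
    proof -
      have "?B a X * ?B b Y = four_block_mat
          ((a \<cdot>\<^sub>m 1\<^sub>m 1) * (b \<cdot>\<^sub>m 1\<^sub>m 1) + 0\<^sub>m 1 n * 0\<^sub>m n 1) ((a \<cdot>\<^sub>m 1\<^sub>m 1) * 0\<^sub>m 1 n + 0\<^sub>m 1 n * Y)
          (0\<^sub>m n 1 * (b \<cdot>\<^sub>m 1\<^sub>m 1) + X * 0\<^sub>m n 1) (0\<^sub>m n 1 * 0\<^sub>m 1 n + X * Y)"
        using that by (intro mult_four_block_mat) auto
      also have "\<dots> = ?B (a * b) (X * Y)"
        using that by (intro arg_cong4[where f = four_block_mat] eq_matI) (auto simp: scalar_prod_def)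
      finally show ?thesis .
    qed
    have B1: "?B 1 (1\<^sub>m n) = 1\<^sub>m (Suc n)" by (intro eq_matI) auto
    define V where "V = ?B 1 U"
    have Vc: "V \<in> carrier_mat (Suc n) (Suc n)"
      unfolding V_def using four_block_carrier_mat[of "1 \<cdot>\<^sub>m 1\<^sub>m 1" 1 1 U n n] Uu by auto
    have Vadj: "mat_adjoint V = ?B 1 (mat_adjoint U)"
      using Uu(1) Vc by (intro eq_matI) (auto simp: V_def)
    have VV: "mat_adjoint V * V = 1\<^sub>m (Suc n)"
    proof -
      have "mat_adjoint V * V = ?B (1 * 1) (mat_adjoint U * U)"
        unfolding Vadj unfolding V_def using Uu(1) by (intro Bmult) auto
      then show ?thesis using Uu(2) B1 by simp
    qed
    have V: "V \<in> unitary_mats (Suc n)" using VV Vc by (auto simp: unitary_mats_def)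
    have GB: "G = ?B k G'"
    proof (rule eq_matI)
      fix i j assume "i < dim_row (?B k G')" "j < dim_col (?B k G')"
      then have ij: "i < Suc n" "j < Suc n" by (auto simp: G'_def)
      then show "G $$ (i, j) = ?B k G' $$ (i, j)"
        using G0[OF ij(1)] G0[OF ij(2)] Gsym[OF ij(2,1)]
        by (cases i; cases j) (auto simp: G'_def)
    qed (use Gc in \<open>auto simp: G'_def\<close>)
    have "mat_adjoint V * G * V = ?B k (mat_diag n (\<lambda>i. complex_of_real (d i)))"
    proof -
      have G'c: "G' \<in> carrier_mat n n" by (simp add: G'_def)
      have Ua: "mat_adjoint U \<in> carrier_mat n n" using Uu(1) by auto
      then have UG: "mat_adjoint U * G' \<in> carrier_mat n n" using G'c by auto
      have "mat_adjoint V * G * V = ?B (1 * k * 1) (mat_adjoint U * G' * U)"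
        unfolding Vadj GB unfolding V_def Bmult[OF Ua G'c] Bmult[OF UG Uu(1)] ..
      then show ?thesis using d by simp
    qed
    also have "\<dots> = mat_diag (Suc n) (\<lambda>i. complex_of_real (case i of 0 \<Rightarrow> Re k | Suc i \<Rightarrow> d i))"
    proof (rule eq_matI)
      fix i j :: nat
      assume "i < dim_row (mat_diag (Suc n) (\<lambda>i. complex_of_real (case i of 0 \<Rightarrow> Re k | Suc i \<Rightarrow> d i)))"
        "j < dim_col (mat_diag (Suc n) (\<lambda>i. complex_of_real (case i of 0 \<Rightarrow> Re k | Suc i \<Rightarrow> d i)))"
      then show "?B k (mat_diag n (\<lambda>i. complex_of_real (d i))) $$ (i, j)
          = mat_diag (Suc n) (\<lambda>i. complex_of_real (case i of 0 \<Rightarrow> Re k | Suc i \<Rightarrow> d i)) $$ (i, j)"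
        using k[symmetric] by (cases i; cases j) (auto simp: mat_diag_def)
    qed (auto simp: mat_diag_def)
    also have "mat_adjoint V * G * V = mat_adjoint (W * V) * H * (W * V)"
    proof -
      have c: "mat_adjoint V \<in> carrier_mat (Suc n) (Suc n)" "mat_adjoint W \<in> carrier_mat (Suc n) (Suc n)"
        using Vc Wu by auto
      have "mat_adjoint (W * V) * H * (W * V) = mat_adjoint V * mat_adjoint W * H * (W * V)"
        using Wu(1) Vc by (simp add: mat_adjoint_mult[of _ "Suc n" "Suc n" _ "Suc n"])
      also have "\<dots> = mat_adjoint V * G * V"
      proof -
        have X: "mat_adjoint W * H \<in> carrier_mat (Suc n) (Suc n)" using c H by auto
        then have VX: "mat_adjoint V * (mat_adjoint W * H) \<in> carrier_mat (Suc n) (Suc n)"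
          using c by auto
        show ?thesis
          unfolding G_def assoc_mult_mat[OF c H] assoc_mult_mat[OF VX Wu(1) Vc, symmetric]
            assoc_mult_mat[OF c(1) X Wu(1)] ..
      qed
      finally show ?thesis ..
    qed
    finally show ?case using unitary_mats_mult[OF W V] by blast
  qed
  then show ?thesis using that by blast
qed

section \<open>The open family\<close>

lemma re_form_mat_diag:
  assumes "y \<in> carrier_vec n"
  shows "re_form (mat_diag n (\<lambda>i. complex_of_real (d i))) y = (\<Sum>i<n. d i * (cmod (y $ i))\<^sup>2)"
proof -
  have "(mat_diag n (\<lambda>i. complex_of_real (d i)) *\<^sub>v y) $ i = complex_of_real (d i) * y $ i"
    if "i < n" for i
  proof -
    have "(mat_diag n (\<lambda>i. complex_of_real (d i)) *\<^sub>v y) $ i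
        = (\<Sum>j<n. (if i = j then complex_of_real (d j) else 0) * y $ j)"
      using that assms by (simp add: mat_diag_def scalar_prod_def atLeast0LessThan)
    also have "\<dots> = (\<Sum>j<n. if j = i then complex_of_real (d i) * y $ i else 0)"
      by (intro sum.cong) auto
    finally show ?thesis using that by simp
  qed
  then have "(mat_diag n (\<lambda>i. complex_of_real (d i)) *\<^sub>v y) \<bullet>c y
      = (\<Sum>i<n. complex_of_real (d i * (cmod (y $ i))\<^sup>2))"
    using assms
    by (auto simp: scalar_prod_def atLeast0LessThan complex_norm_square mult.assoc
        simp del: of_real_power intro!: sum.cong)
  then show ?thesis by simp
qed

lemma unitary_isometry:
  assumes "U \<in> unitary_mats n" "y \<in> carrier_vec n"
  shows "(U *\<^sub>v y) \<bullet>c (U *\<^sub>v y) = y \<bullet>c y"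
proof -
  note U = unitary_matsD[OF assms(1)]
  have "mat_adjoint U *\<^sub>v (U *\<^sub>v y) = y"
    using U assms(2) by (simp flip: assoc_mult_mat_vec[of _ n n])
  then show ?thesis
    using U(1) assms(2) by (simp add: cscalar_prod_adjoint[OF U(1)])
qed

text \<open>In a unitary eigenbasis of \<open>A + mat_adjoint A\<close> the form is a sum of squares
  with finitely many positive weights, so the least weight gives a uniform bound. This replaces a
  compactness argument on the unit sphere.\<close>

lemma positive_form_coercive:
  assumes A: "A \<in> carrier_mat n n"
    and pos: "\<And>x. x \<in> carrier_vec n \<Longrightarrow> x \<noteq> 0\<^sub>v n \<Longrightarrow> 0 < re_form A x"
  shows "\<exists>c>0. \<forall>x\<in>carrier_vec n. c * Re (x \<bullet>c x) \<le> re_form A x"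
proof -
  let ?H = "A + mat_adjoint A"
  have H: "?H \<in> carrier_mat n n" using A by auto
  obtain U d where U: "U \<in> unitary_mats n"
    and d: "mat_adjoint U * ?H * U = mat_diag n (\<lambda>i. complex_of_real (d i))"
    using hermitian_diagonalization[OF add_adjoint_hermitian[OF A]] .
  note Uu = unitary_matsD[OF U]
  have form: "2 * re_form A (U *\<^sub>v y) = (\<Sum>i<n. d i * (cmod (y $ i))\<^sup>2)" if y: "y \<in> carrier_vec n" for y
  proof -
    have "2 * re_form A (U *\<^sub>v y) = re_form ?H (U *\<^sub>v y)"
      using A Uu(1) y by (simp add: re_form_add_adjoint[of _ n])
    also have "\<dots> = re_form (mat_adjoint U * ?H * U) y"
      using re_form_congruence[OF H Uu(1) y] by simp
    finally show ?thesis unfolding d re_form_mat_diag[OF y] .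
  qed
  have dpos: "0 < d i" if i: "i < n" for i
  proof -
    let ?e = "unit_vec n i :: complex vec"
    have "U *\<^sub>v ?e \<noteq> 0\<^sub>v n"
    proof
      assume "U *\<^sub>v ?e = 0\<^sub>v n"
      then have "?e \<bullet>c ?e = 0" using unitary_isometry[OF U, of ?e] by simp
      then show False using i by simp
    qed
    then have "0 < re_form A (U *\<^sub>v ?e)" using Uu(1) by (intro pos) auto
    moreover have "(\<Sum>j<n. d j * (cmod (?e $ j))\<^sup>2) = (\<Sum>j<n. if j = i then d i else 0)"
      using i by (intro sum.cong) auto
    ultimately show ?thesis using form[of ?e] i by simp
  qed
  \<comment> \<open>The division by 2 undoes the doubling of the form in
    \<open>A + mat_adjoint A\<close>; the inserted 1 keeps \<open>Min\<close> meaningful when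
    \<open>n = 0\<close>.\<close>
  define c where "c = Min (insert 1 (d ` {..<n})) / 2"
  have "0 < Min (insert 1 (d ` {..<n}))" using dpos by (subst Min_gr_iff) auto
  then have c: "0 < c" by (simp add: c_def)
  have cd: "2 * c \<le> d i" if "i < n" for i
  proof -
    have "Min (insert 1 (d ` {..<n})) \<le> d i" using that by (intro Min_le) auto
    then show ?thesis by (simp add: c_def)
  qed
  have "c * Re (x \<bullet>c x) \<le> re_form A x" if x: "x \<in> carrier_vec n" for x
  proof -
    define y where "y = mat_adjoint U *\<^sub>v x"
    have y: "y \<in> carrier_vec n"
      unfolding y_def using Uu(1) x by (intro mult_mat_vec_carrier[of _ n n] mat_adjoint_carrier)
    have Uy: "U *\<^sub>v y = x"
      unfolding y_def using Uu x assoc_mult_mat_vec[of U n n "mat_adjoint U" n x] by simp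
    have "2 * c * Re (y \<bullet>c y) = (\<Sum>i<n. 2 * c * (cmod (y $ i))\<^sup>2)"
      using y by (simp add: Re_cscalar_prod_self sum_distrib_left)
    also have "\<dots> \<le> (\<Sum>i<n. d i * (cmod (y $ i))\<^sup>2)"
      using cd by (intro sum_mono mult_right_mono) auto
    also have "\<dots> = 2 * re_form A x" using form[OF y] Uy by simp
    finally show ?thesis using unitary_isometry[OF U y] Uy by simp
  qed
  then show ?thesis using c by blast
qed

lemma of_size_L_I:
  assumes "1 \<le> n"
  shows "of_size L_I n = {A \<in> carrier_mat n n. \<forall>x\<in>carrier_vec n. x \<noteq> 0\<^sub>v n \<longrightarrow> 0 < re_form A x}"
  using assms by (auto simp: of_size_def L_I_iff)

lemma of_size_L_I_bar:
  assumes "1 \<le> n"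
  shows "of_size L_I_bar n = {A \<in> carrier_mat n n. \<forall>x\<in>carrier_vec n. 0 \<le> re_form A x}"
  using assms by (auto simp: of_size_def L_I_bar_iff)

lemma openin_L_I:
  assumes n: "1 \<le> n"
  shows "openin (mat_topology n) (of_size L_I n)"
proof (rule openin_mat_topologyI)
  show "of_size L_I n \<subseteq> carrier_mat n n" by (auto simp: of_size_def)
  fix A assume "A \<in> of_size L_I n"
  then have A: "A \<in> carrier_mat n n"
    and pos: "\<And>x. x \<in> carrier_vec n \<Longrightarrow> x \<noteq> 0\<^sub>v n \<Longrightarrow> 0 < re_form A x"
    by (auto simp: of_size_L_I[OF n])
  obtain c where c: "0 < c" "\<And>x. x \<in> carrier_vec n \<Longrightarrow> c * Re (x \<bullet>c x) \<le> re_form A x"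
    using positive_form_coercive[OF A pos] by blast
  \<comment> \<open>With this radius the form changes by at most half of its lower bound
    \<open>c * Re (x \<bullet>c x)\<close>, so the other half survives.\<close>
  have "B \<in> of_size L_I n" if B: "B \<in> carrier_mat n n" "entries_near n (c / (2 * n)) A B" for B
    unfolding of_size_L_I[OF n]
  proof (intro CollectI conjI ballI impI B(1))
    fix x :: "complex vec" assume x: "x \<in> carrier_vec n" "x \<noteq> 0\<^sub>v n"
    have "\<bar>re_form B x - re_form A x\<bar> \<le> c / (2 * n) * n * Re (x \<bullet>c x)"
      using A B(1) x(1) B(2) by (rule re_form_near)
    also have "\<dots> = c / 2 * Re (x \<bullet>c x)" using n by simp
    finally have "c / 2 * Re (x \<bullet>c x) \<le> re_form B x" using c(2)[OF x(1)] by linarith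
    moreover have "0 < c / 2 * Re (x \<bullet>c x)"
      using c(1) Re_cscalar_prod_self_pos[OF x] by (intro mult_pos_pos) auto
    ultimately show "0 < re_form B x" by linarith
  qed
  then show "\<exists>e>0. \<forall>B\<in>carrier_mat n n. entries_near n e A B \<longrightarrow> B \<in> of_size L_I n"
    using c(1) n by (intro exI[of _ "c / (2 * n)"]) auto
qed

section \<open>Kernels, and the maximality of \<open>L_I\<close>\<close>

lemma not_invertible_mat:
  fixes M :: "complex mat"
  assumes M: "M \<in> carrier_mat n n" and x: "x \<in> carrier_vec n" "x \<noteq> 0\<^sub>v n" "M *\<^sub>v x = 0\<^sub>v n"
  shows "\<not> invertible_mat M"
proof
  assume "invertible_mat M"
  then obtain N where "inverts_mat M N" "inverts_mat N M" by (auto simp: invertible_mat_def)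
  note N = inverts_mat_carrier[OF M this]
  have "N *\<^sub>v (M *\<^sub>v x) \<noteq> 0\<^sub>v n"
    using inverse_mult_vec_nonzero[OF N(1) M N(3) x(1,2)] x(3) by simp
  then show False using x(3) N(1) by auto
qed

lemma invertible_matI_kernel:
  fixes M :: "complex mat"
  assumes M: "M \<in> carrier_mat n n"
    and ker: "\<And>x. x \<in> carrier_vec n \<Longrightarrow> M *\<^sub>v x = 0\<^sub>v n \<Longrightarrow> x = 0\<^sub>v n"
  shows "invertible_mat M"
proof -
  have "det M \<noteq> 0" using ker det_0_iff_vec_prod_zero_field[OF M] by blast
  then obtain N where "N \<in> carrier_mat n n" "N * M = 1\<^sub>m n" "M * N = 1\<^sub>m n"
    using det_non_zero_imp_unit[OF M] by (auto simp: Units_def ring_mat_def)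
  then show ?thesis using M by (auto simp: invertible_mat_def inverts_mat_def)
qed

lemma L_I_invertible:
  assumes "A \<in> L_I"
  shows "invertible_mat A"
proof -
  obtain n where A: "A \<in> carrier_mat n n"
    using assms by (blast elim: square_matE dest: family_square_mat)
  show ?thesis
  proof (rule invertible_matI_kernel[OF A], rule ccontr)
    fix x assume x: "x \<in> carrier_vec n" "A *\<^sub>v x = 0\<^sub>v n" "x \<noteq> 0\<^sub>v n"
    then have "0 < re_form A x" using assms by (auto simp: L_I_iff[OF A])
    then show False using x by simp
  qed
qed

lemma mat_mult_vec_sum:
  fixes M :: "complex mat"
  assumes "M \<in> carrier_mat n n" "x \<in> carrier_vec n" "i < n"
  shows "(M *\<^sub>v x) $ i = (\<Sum>j<n. M $$ (i, j) * x $ j)"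
  using assms by (auto simp: scalar_prod_def atLeast0LessThan)

text \<open>The condition \<open>orth\<close> is forced, since the form of a skew-Hermitian matrix
  vanishes at \<open>x\<close>. The lemma supplies the converse.\<close>

lemma skew_hermitian_with_value:
  fixes x w :: "complex vec"
  assumes x: "x \<in> carrier_vec n" "x \<noteq> 0\<^sub>v n" and w: "w \<in> carrier_vec n"
    and orth: "Re (w \<bullet>c x) = 0"
  obtains K where "K \<in> skew_hermitian_mats n" "K *\<^sub>v x = w"
proof -
  define m where "m = Re (x \<bullet>c x)"
  have m: "0 < m" using Re_cscalar_prod_self_pos[OF x] by (simp add: m_def)
  have xx: "(\<Sum>j<n. x $ j * cnj (x $ j)) = complex_of_real m"
  proof -
    have "x \<bullet>c x = complex_of_real m"
      unfolding m_def cscalar_prod_self Re_complex_of_real ..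
    then show ?thesis using x by (auto simp: scalar_prod_def atLeast0LessThan)
  qed
  define b where "b = x \<bullet>c w"
  have b: "cnj b = - b"
    using orth cscalar_prod_commute[OF x(1) w] by (simp add: b_def complex_eq_iff)
  have xw: "(\<Sum>j<n. x $ j * cnj (w $ j)) = b"
    using x w by (auto simp: b_def scalar_prod_def atLeast0LessThan)
  \<comment> \<open>The first part is the skew-Hermitian matrix built from \<open>w\<close> and
    \<open>x\<close>; it sends \<open>x\<close> to \<open>w\<close> minus \<open>b / m\<close> times
    \<open>x\<close>. The rank-one term restores the missing multiple of \<open>x\<close>, and it is
    skew-Hermitian because \<open>b\<close> is imaginary.\<close>
  define K where "K = mat n n (\<lambda>(i, j). (w $ i * cnj (x $ j) - x $ i * cnj (w $ j)) / of_real m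
      + b / of_real (m * m) * x $ i * cnj (x $ j))"
  have K: "K \<in> carrier_mat n n" by (simp add: K_def)
  have "mat_adjoint K = - K"
    using b by (intro eq_matI) (auto simp: K_def diff_divide_distrib mult_ac)
  then have "K \<in> skew_hermitian_mats n" using K by (simp add: skew_hermitian_mats_def)
  moreover have "K *\<^sub>v x = w"
  proof (rule eq_vecI)
    fix i assume "i < dim_vec w"
    then have i: "i < n" using w by auto
    have "(K *\<^sub>v x) $ i = (\<Sum>j<n. w $ i / of_real m * (x $ j * cnj (x $ j))
        - x $ i / of_real m * (x $ j * cnj (w $ j))
        + b / of_real (m * m) * x $ i * (x $ j * cnj (x $ j)))"
      unfolding mat_mult_vec_sum[OF K x(1) i]
      using i by (intro sum.cong) (auto simp: K_def algebra_simps diff_divide_distrib add_divide_distrib)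
    also have "\<dots> = w $ i / of_real m * of_real m - x $ i / of_real m * b
        + b / of_real (m * m) * x $ i * of_real m"
      unfolding sum.distrib sum_subtractf sum_distrib_left[symmetric] xx xw ..
    also have "\<dots> = w $ i" using m by (simp add: field_simps)
    finally show "(K *\<^sub>v x) $ i = w $ i" .
  qed (use K w in auto)
  ultimately show ?thesis by (rule that)
qed

lemma one_L_I: "1 \<le> n \<Longrightarrow> 1\<^sub>m n \<in> L_I"
  using Re_cscalar_prod_self_pos by (auto simp: L_I_iff[OF one_carrier_mat])

lemma smult_one_mult_vec:
  fixes x :: "complex vec"
  assumes "x \<in> carrier_vec n"
  shows "(c \<cdot>\<^sub>m 1\<^sub>m n) *\<^sub>v x = c \<cdot>\<^sub>v x"
  using assms by (simp add: smult_mat_mult_vec[of _ n n])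

lemma re_form_add_smult_one:
  assumes "A \<in> carrier_mat n n" "x \<in> carrier_vec n"
  shows "re_form (A + complex_of_real r \<cdot>\<^sub>m 1\<^sub>m n) x = re_form A x + r * Re (x \<bullet>c x)"
  using assms by (simp add: re_form_add[of _ n] re_form_smult[of _ n] del: one_mult_mat_vec)
    (simp add: re_form_one)

lemma entries_near_add_smult_one:
  assumes "A \<in> carrier_mat n n" "\<bar>r\<bar> < e"
  shows "entries_near n e A (A + complex_of_real r \<cdot>\<^sub>m 1\<^sub>m n)"
  using assms by (auto simp: entries_near_def)

lemma maximal_nonsingular_L_I:
  assumes n: "1 \<le> n"
  shows "maximal_nonsingular n (of_size L_I n)"
  unfolding maximal_nonsingular_def
proof (intro ballI impI)
  fix B assume B: "B \<in> carrier_mat n n"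
    and notin: "B \<notin> mat_topology n closure_of of_size L_I n"
  \<comment> \<open>If the form of \<open>B\<close> were nonnegative, \<open>B\<close> would be a
    limit of the matrices \<open>B + (e / 2) I\<close>, which lie in \<open>L_I\<close>.\<close>
  have "\<exists>x\<in>carrier_vec n. re_form B x < 0"
  proof (rule ccontr)
    assume "\<not> (\<exists>x\<in>carrier_vec n. re_form B x < 0)"
    then have nonneg: "0 \<le> re_form B x" if "x \<in> carrier_vec n" for x using that by force
    have "\<exists>A\<in>of_size L_I n \<inter> carrier_mat n n. entries_near n e B A" if e: "e > 0" for e
    proof
      show "entries_near n e B (B + complex_of_real (e / 2) \<cdot>\<^sub>m 1\<^sub>m n)"
        using B e by (intro entries_near_add_smult_one) auto
      have "0 < re_form (B + complex_of_real (e / 2) \<cdot>\<^sub>m 1\<^sub>m n) x"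
        if x: "x \<in> carrier_vec n" "x \<noteq> 0\<^sub>v n" for x
        unfolding re_form_add_smult_one[OF B x(1)]
        using nonneg[OF x(1)] Re_cscalar_prod_self_pos[OF x] e by (intro add_nonneg_pos) auto
      then show "B + complex_of_real (e / 2) \<cdot>\<^sub>m 1\<^sub>m n \<in> of_size L_I n \<inter> carrier_mat n n"
        using B by (auto simp: of_size_L_I[OF n])
    qed
    then show False using notin B by (auto simp: in_closure_of_mat_topology)
  qed
  then obtain x where x: "x \<in> carrier_vec n" and neg: "re_form B x < 0" by blast
  then have x0: "x \<noteq> 0\<^sub>v n" using B by auto
  define m where "m = Re (x \<bullet>c x)"
  have m: "0 < m" using Re_cscalar_prod_self_pos[OF x x0] by (simp add: m_def)
  \<comment> \<open>This \<open>r\<close> makes \<open>w = - B x - r x\<close> satisfy the real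
    orthogonality to \<open>x\<close> that a skew-Hermitian value requires. Then
    \<open>K + r I + B\<close> kills \<open>x\<close>.\<close>
  define r where "r = - re_form B x / m"
  have r: "0 < r" using m neg by (simp add: r_def divide_neg_pos)
  define w where "w = - 1 \<cdot>\<^sub>v (B *\<^sub>v x) + complex_of_real (- r) \<cdot>\<^sub>v x"
  have Bx: "B *\<^sub>v x \<in> carrier_vec n" using B x by auto
  then have w: "w \<in> carrier_vec n" using x by (simp add: w_def)
  have "Re (w \<bullet>c x) = - re_form B x - r * m"
    using x Bx unfolding w_def
    by (simp add: cscalar_prod_add_left[of _ n] cscalar_prod_smult_left[of _ n] m_def)
  then have "Re (w \<bullet>c x) = 0" using m by (simp add: r_def)
  then obtain K where K: "K \<in> skew_hermitian_mats n" "K *\<^sub>v x = w"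
    using skew_hermitian_with_value[OF x x0 w] by blast
  have Kc: "K \<in> carrier_mat n n" using K by (simp add: skew_hermitian_mats_def)
  let ?A = "K + complex_of_real r \<cdot>\<^sub>m 1\<^sub>m n"
  have "0 < re_form ?A y" if y: "y \<in> carrier_vec n" "y \<noteq> 0\<^sub>v n" for y
    unfolding re_form_add_smult_one[OF Kc y(1)]
    using K(1) skew_hermitian_iff[OF Kc] y r Re_cscalar_prod_self_pos[OF y] by simp
  then have "?A \<in> of_size L_I n" using Kc by (auto simp: of_size_L_I[OF n])
  moreover have "(?A + B) *\<^sub>v x = 0\<^sub>v n"
  proof -
    have "(?A + B) *\<^sub>v x = w + complex_of_real r \<cdot>\<^sub>v x + B *\<^sub>v x"
      using Kc B x K(2) w Bx
      by (simp add: add_mult_distrib_mat_vec[of _ n n] smult_one_mult_vec assoc_add_vec[of _ n])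
    also have "\<dots> = 0\<^sub>v n"
    proof -
      have "- 1 \<cdot>\<^sub>v y + complex_of_real (- r) \<cdot>\<^sub>v x + complex_of_real r \<cdot>\<^sub>v x + y = 0\<^sub>v n"
        if "y \<in> carrier_vec n" for y
        using x that by (intro eq_vecI) auto
      then show ?thesis unfolding w_def using Bx by blast
    qed
    finally show ?thesis .
  qed
  then have "\<not> invertible_mat (?A + B)" using Kc B x x0 by (intro not_invertible_mat[of _ n x]) auto
  ultimately show "\<exists>A\<in>of_size L_I n. \<not> invertible_mat (A + B)" by blast
qed

section \<open>Maximal unitarily invariant cones\<close>

lemma mat_eq_by_action:
  fixes A B :: "complex mat"
  assumes A: "A \<in> carrier_mat n n" and B: "B \<in> carrier_mat n n"
    and eq: "\<And>x. x \<in> carrier_vec n \<Longrightarrow> A *\<^sub>v x = B *\<^sub>v x"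
  shows "A = B"
proof (rule eq_matI)
  fix i j assume "i < dim_row B" "j < dim_col B"
  then have ij: "i < n" "j < n" using B by auto
  have "(A *\<^sub>v unit_vec n j) $ i = (B *\<^sub>v unit_vec n j) $ i" using eq by simp
  then show "A $$ (i, j) = B $$ (i, j)" using A B ij by simp
qed (use A B in auto)

text \<open>This is the Householder reflection: it negates \<open>x\<close> and fixes its orthogonal
  complement. It squares to the identity because the component along \<open>x\<close> changes sign,
  so the second application restores what the first subtracted.\<close>

lemma reflection_matrix:
  fixes x :: "complex vec"
  assumes x: "x \<in> carrier_vec n" "x \<noteq> 0\<^sub>v n"
  obtains R where "R \<in> unitary_mats n" "mat_adjoint R = R"
    "\<And>y. y \<in> carrier_vec n \<Longrightarrow>
      R *\<^sub>v y = y + (- (2 * (y \<bullet>c x) / complex_of_real (Re (x \<bullet>c x)))) \<cdot>\<^sub>v x"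
proof -
  define m where "m = Re (x \<bullet>c x)"
  have m: "0 < m" using Re_cscalar_prod_self_pos[OF x] by (simp add: m_def)
  have xx: "x \<bullet>c x = complex_of_real m"
    unfolding m_def cscalar_prod_self Re_complex_of_real ..
  define R where "R = mat n n (\<lambda>(i, j). (if i = j then 1 else 0) - 2 / of_real m * x $ i * cnj (x $ j))"
  have R: "R \<in> carrier_mat n n" by (simp add: R_def)
  have adj: "mat_adjoint R = R" by (intro eq_matI) (auto simp: R_def)
  have act: "R *\<^sub>v y = y + (- (2 * (y \<bullet>c x) / of_real m)) \<cdot>\<^sub>v x" if y: "y \<in> carrier_vec n" for y
  proof (rule eq_vecI)
    fix i assume "i < dim_vec (y + (- (2 * (y \<bullet>c x) / of_real m)) \<cdot>\<^sub>v x)"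
    then have i: "i < n" using x by simp
    have yx: "y \<bullet>c x = (\<Sum>j<n. y $ j * cnj (x $ j))"
      using x y by (auto simp: scalar_prod_def atLeast0LessThan)
    have "(R *\<^sub>v y) $ i = (\<Sum>j<n. (if j = i then y $ i else 0)
        + (- (2 / of_real m * x $ i)) * (y $ j * cnj (x $ j)))"
      unfolding mat_mult_vec_sum[OF R y i]
      using i by (intro sum.cong) (auto simp: R_def algebra_simps)
    also have "\<dots> = y $ i + (- (2 / of_real m * x $ i)) * (y \<bullet>c x)"
      unfolding sum.distrib sum_distrib_left[symmetric] yx using i by simp
    finally show "(R *\<^sub>v y) $ i = (y + (- (2 * (y \<bullet>c x) / of_real m)) \<cdot>\<^sub>v x) $ i"
      using i x y by simp
  qed (use R x y in auto)
  have "R * R = 1\<^sub>m n"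
  proof (rule mat_eq_by_action)
    fix y :: "complex vec" assume y: "y \<in> carrier_vec n"
    let ?c = "- (2 * (y \<bullet>c x) / of_real m)"
    have cx: "?c \<cdot>\<^sub>v x \<in> carrier_vec n" using x by simp
    have "(y + ?c \<cdot>\<^sub>v x) \<bullet>c x = y \<bullet>c x + ?c * (x \<bullet>c x)"
      using x y cx by (simp add: cscalar_prod_add_left[of _ n])
    also have "\<dots> = - (y \<bullet>c x)" unfolding xx using m by simp
    finally have e: "(y + ?c \<cdot>\<^sub>v x) \<bullet>c x = - (y \<bullet>c x)" .
    have "(R * R) *\<^sub>v y = R *\<^sub>v (y + ?c \<cdot>\<^sub>v x)"
      using R y act[OF y] assoc_mult_mat_vec[OF R R y] by simp
    also have "\<dots> = (y + ?c \<cdot>\<^sub>v x) + (- ?c) \<cdot>\<^sub>v x"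
      using act[of "y + ?c \<cdot>\<^sub>v x"] y cx e by simp
    also have "\<dots> = y"
      using x y by (intro eq_vecI) auto
    finally show "(R * R) *\<^sub>v y = 1\<^sub>m n *\<^sub>v y" using y by simp
  qed (use R in auto)
  then have "R \<in> unitary_mats n" using R adj by (simp add: unitary_mats_def)
  then show ?thesis using adj act that unfolding m_def by blast
qed

locale unitary_invariant_cone =
  fixes n :: nat and S :: "complex mat set"
  assumes n: "1 \<le> n"
    and cone: "mat_cone S"
    and inversion: "closed_under_inversion S"
    and one: "1\<^sub>m n \<in> S"
    and maximal: "maximal_open_convex_nonsingular n S"
    and unitary: "\<And>A U. A \<in> S \<Longrightarrow> U \<in> unitary_mats n \<Longrightarrow> mat_adjoint U * A * U \<in> S"
begin

lemma carrier: "A \<in> S \<Longrightarrow> A \<in> carrier_mat n n"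
  using maximal by (auto simp: maximal_open_convex_nonsingular_def convex_mats_def)

lemma nonsingular: "A \<in> S \<Longrightarrow> invertible_mat A"
  using maximal by (auto simp: maximal_open_convex_nonsingular_def)

lemma smult: "A \<in> S \<Longrightarrow> 0 < r \<Longrightarrow> complex_of_real r \<cdot>\<^sub>m A \<in> S"
  using cone by (auto simp: mat_cone_def)

lemma midpoint:
  assumes "A \<in> S" "B \<in> S"
  shows "complex_of_real (1 / 2) \<cdot>\<^sub>m A + complex_of_real (1 / 2) \<cdot>\<^sub>m B \<in> S"
proof -
  have "complex_of_real (1 / 2) \<cdot>\<^sub>m A + complex_of_real (1 - 1 / 2) \<cdot>\<^sub>m B \<in> S"
  proof -
    have "(1 / 2 :: real) \<in> {0..1}" by simp
    then show ?thesis
      using maximal assms unfolding maximal_open_convex_nonsingular_def convex_mats_def by blast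
  qed
  then show ?thesis by simp
qed

text \<open>Convexity yields averages only; averaging the doubled matrices gives the sum.\<close>

lemma add: "A \<in> S \<Longrightarrow> B \<in> S \<Longrightarrow> A + B \<in> S"
proof -
  assume AB: "A \<in> S" "B \<in> S"
  have "complex_of_real 2 \<cdot>\<^sub>m A \<in> S" "complex_of_real 2 \<cdot>\<^sub>m B \<in> S"
    using AB by (auto intro: smult simp del: of_real_numeral)
  note midpoint[OF this]
  moreover have "complex_of_real (1 / 2) \<cdot>\<^sub>m (complex_of_real 2 \<cdot>\<^sub>m A)
      + complex_of_real (1 / 2) \<cdot>\<^sub>m (complex_of_real 2 \<cdot>\<^sub>m B) = A + B"
    using AB[THEN carrier] by (intro eq_matI) auto
  ultimately show ?thesis by simp
qed

text \<open>
  Averaging \<open>A\<close> with its conjugate under the reflection in \<open>x\<close> turns \<open>x\<close> into an eigenvector,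
  with eigenvalue \<open>\<lambda> = x\<^sup>* A x / x\<^sup>* x\<close>. On it the averaged matrix \<open>A'\<close> satisfies
  \<open>A' + |\<lambda>|\<^sup>2 A'\<^sup>-\<^sup>1 = 2 Re \<lambda>\<close>, so a nonpositive \<open>Re \<lambda>\<close> would put a singular matrix into the cone.
\<close>

lemma re_form_pos:
  assumes A: "A \<in> S" and x: "x \<in> carrier_vec n" "x \<noteq> 0\<^sub>v n"
  shows "0 < re_form A x"
proof (rule ccontr)
  assume "\<not> 0 < re_form A x"
  then have np: "re_form A x \<le> 0" by simp
  define m where "m = Re (x \<bullet>c x)"
  have m: "0 < m" using Re_cscalar_prod_self_pos[OF x] by (simp add: m_def)
  have xx: "x \<bullet>c x = complex_of_real m"
    unfolding m_def cscalar_prod_self Re_complex_of_real ..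
  note Ac = carrier[OF A]
  obtain R where R: "R \<in> unitary_mats n" "mat_adjoint R = R"
    and act: "\<And>y. y \<in> carrier_vec n \<Longrightarrow> R *\<^sub>v y = y + (- (2 * (y \<bullet>c x) / complex_of_real m)) \<cdot>\<^sub>v x"
    using reflection_matrix[OF x] unfolding m_def by blast
  have Rc: "R \<in> carrier_mat n n" using R(1) by (simp add: unitary_mats_def)
  define l where "l = ((A *\<^sub>v x) \<bullet>c x) / complex_of_real m"
  have "Re l = re_form A x / m" by (simp add: l_def)
  then have l: "Re l \<le> 0" using np m by (simp add: divide_nonpos_pos)
  define A' where "A' = complex_of_real (1 / 2) \<cdot>\<^sub>m A + complex_of_real (1 / 2) \<cdot>\<^sub>m (R * A * R)"
  have A': "A' \<in> S" unfolding A'_def using midpoint[OF A unitary[OF A R(1)]] R(2) by simp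
  note A'c = carrier[OF A']
  have Ax: "A *\<^sub>v x \<in> carrier_vec n" using Ac x by auto
  \<comment> \<open>As \<open>R\<close> negates \<open>x\<close>, the conjugate of \<open>A\<close>
    sends \<open>x\<close> to \<open>2 l x - A x\<close>, and in the average the two occurrences of
    \<open>A x\<close> cancel.\<close>
  have A'x: "A' *\<^sub>v x = l \<cdot>\<^sub>v x"
  proof -
    have RA: "R * A \<in> carrier_mat n n" "R * A * R \<in> carrier_mat n n" using Rc Ac by auto
    have "R *\<^sub>v x = - 1 \<cdot>\<^sub>v x"
      unfolding act[OF x(1)] xx using x m by (intro eq_vecI) auto
    then have "(R * A * R) *\<^sub>v x = - 1 \<cdot>\<^sub>v (R *\<^sub>v (A *\<^sub>v x))"
      using RA Rc Ac x Ax assoc_mult_mat_vec[OF RA(1) Rc x(1)] assoc_mult_mat_vec[OF Rc Ac x(1)]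
      by (simp add: mult_mat_vec[of _ n n])
    also have "R *\<^sub>v (A *\<^sub>v x) = A *\<^sub>v x + (- (2 * l)) \<cdot>\<^sub>v x"
      unfolding act[OF Ax] by (simp add: l_def)
    finally have "A' *\<^sub>v x = complex_of_real (1 / 2) \<cdot>\<^sub>v (A *\<^sub>v x)
        + complex_of_real (1 / 2) \<cdot>\<^sub>v (- 1 \<cdot>\<^sub>v (A *\<^sub>v x + (- (2 * l)) \<cdot>\<^sub>v x))"
      unfolding A'_def using Ac RA x
      by (simp add: add_mult_distrib_mat_vec[of _ n n] smult_mat_mult_vec[of _ n n])
    also have "\<dots> = l \<cdot>\<^sub>v x"
    proof -
      have "complex_of_real (1 / 2) \<cdot>\<^sub>v y + complex_of_real (1 / 2) \<cdot>\<^sub>v (- 1 \<cdot>\<^sub>v (y + (- (2 * l)) \<cdot>\<^sub>v x)) = l \<cdot>\<^sub>v x"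
        if "y \<in> carrier_vec n" for y
        using x that by (intro eq_vecI) (auto simp: algebra_simps)
      then show ?thesis using Ax by blast
    qed
    finally show ?thesis .
  qed
  obtain N where "inverts_mat A' N" "inverts_mat N A'"
    using nonsingular[OF A'] by (auto simp: invertible_mat_def)
  note N = inverts_mat_carrier[OF A'c this]
  have NS: "N \<in> S" using inversion A' \<open>inverts_mat A' N\<close> \<open>inverts_mat N A'\<close>
    by (auto simp: closed_under_inversion_def)
  have l0: "l \<noteq> 0"
  proof
    assume "l = 0"
    then have "A' *\<^sub>v x = 0\<^sub>v n" using A'x x by (auto intro!: eq_vecI)
    then show False using not_invertible_mat[OF A'c x] nonsingular[OF A'] by blast
  qed
  have Nx: "N *\<^sub>v x = (1 / l) \<cdot>\<^sub>v x"
  proof -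
    have Nxc: "N *\<^sub>v x \<in> carrier_vec n" using N(1) x by auto
    have "x = (N * A') *\<^sub>v x" using N(3) x by simp
    also have "\<dots> = l \<cdot>\<^sub>v (N *\<^sub>v x)"
      using assoc_mult_mat_vec[OF N(1) A'c x(1)] A'x N(1) x by (simp add: mult_mat_vec[of _ n n])
    finally have "(1 / l) \<cdot>\<^sub>v x = (1 / l) \<cdot>\<^sub>v (l \<cdot>\<^sub>v (N *\<^sub>v x))" by simp
    also have "\<dots> = N *\<^sub>v x" using l0 by (simp add: smult_smult_assoc)
    finally show ?thesis ..
  qed
  define C where "C = A' + complex_of_real ((cmod l)\<^sup>2) \<cdot>\<^sub>m N"
  have C: "C \<in> S" unfolding C_def using l0 by (intro add A' smult NS) auto
  note Cc = carrier[OF C]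
  have ll: "l + complex_of_real ((cmod l)\<^sup>2) * (1 / l) = complex_of_real (2 * Re l)"
    using l0 unfolding complex_norm_square by (simp add: complex_add_cnj)
  have "C *\<^sub>v x = l \<cdot>\<^sub>v x + complex_of_real ((cmod l)\<^sup>2) \<cdot>\<^sub>v ((1 / l) \<cdot>\<^sub>v x)"
    unfolding C_def using A'c N(1) x A'x Nx
    by (simp add: add_mult_distrib_mat_vec[of _ n n] smult_mat_mult_vec[of _ n n])
  also have "\<dots> = complex_of_real (2 * Re l) \<cdot>\<^sub>v x"
    unfolding ll[symmetric] by (simp add: smult_smult_assoc add_smult_distrib_vec)
  finally have Cx: "C *\<^sub>v x = complex_of_real (2 * Re l) \<cdot>\<^sub>v x" .
  have "\<exists>D\<in>S. D *\<^sub>v x = 0\<^sub>v n"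
  proof (cases "Re l = 0")
    case True
    then have "C *\<^sub>v x = 0\<^sub>v n" using Cx x by (auto intro!: eq_vecI)
    then show ?thesis using C by blast
  next
    case False
    \<comment> \<open>Here \<open>Re l < 0\<close>, so the multiple of the identity that cancels the
      eigenvalue of \<open>C\<close> has a positive coefficient and stays within the cone.\<close>
    let ?D = "C + complex_of_real (- 2 * Re l) \<cdot>\<^sub>m 1\<^sub>m n"
    have "?D \<in> S" using False l by (intro add C smult one) auto
    moreover have "?D *\<^sub>v x = complex_of_real (2 * Re l) \<cdot>\<^sub>v x + complex_of_real (- 2 * Re l) \<cdot>\<^sub>v x"
      using Cc x Cx
      by (simp add: add_mult_distrib_mat_vec[of _ n n] smult_one_mult_vec)
    then have "?D *\<^sub>v x = 0\<^sub>v n" using x by (auto intro!: eq_vecI)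
    ultimately show ?thesis by blast
  qed
  then obtain D where D: "D \<in> S" "D *\<^sub>v x = 0\<^sub>v n" by blast
  then show False using not_invertible_mat[OF carrier[OF D(1)] x D(2)] nonsingular by blast
qed

lemma subset_L_I: "S \<subseteq> of_size L_I n"
  using re_form_pos carrier by (auto simp: of_size_L_I[OF n])

text \<open>
  By maximality the slightly smaller \<open>B - \<epsilon> I\<close> lies in the closure of the cone, and adding
  back \<open>\<epsilon> I\<close>, an interior point, leads into the cone itself.
\<close>

lemma L_I_subset: "of_size L_I n \<subseteq> S"
proof
  fix B assume "B \<in> of_size L_I n"
  then have B: "B \<in> carrier_mat n n"
    and pos: "\<And>x. x \<in> carrier_vec n \<Longrightarrow> x \<noteq> 0\<^sub>v n \<Longrightarrow> 0 < re_form B x"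
    by (auto simp: of_size_L_I[OF n])
  obtain c where c: "0 < c" "\<And>x. x \<in> carrier_vec n \<Longrightarrow> c * Re (x \<bullet>c x) \<le> re_form B x"
    using positive_form_coercive[OF B pos] by blast
  \<comment> \<open>Any positive number below the coercivity constant \<open>c\<close> keeps the
    form of \<open>B - e I\<close> positive.\<close>
  define e where "e = c / 2"
  have e: "0 < e" "e < c" using c(1) by (auto simp: e_def)
  let ?B' = "B + complex_of_real (- e) \<cdot>\<^sub>m 1\<^sub>m n"
  have B': "?B' \<in> carrier_mat n n" using B by simp
  have B'pos: "0 < re_form ?B' x" if x: "x \<in> carrier_vec n" "x \<noteq> 0\<^sub>v n" for x
  proof -
    have "0 < (c - e) * Re (x \<bullet>c x)"
      using Re_cscalar_prod_self_pos[OF x] e by (intro mult_pos_pos) auto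
    then show ?thesis
      unfolding re_form_add_smult_one[OF B x(1)] using c(2)[OF x(1)] by (simp add: algebra_simps)
  qed
  \<comment> \<open>Outside the closure, maximality would give some \<open>A\<close> in the cone
    with \<open>A + ?B'\<close> singular, although both summands have positive forms.\<close>
  have closure: "?B' \<in> mat_topology n closure_of S"
  proof (rule ccontr)
    assume "\<not> ?thesis"
    then obtain A where A: "A \<in> S" "\<not> invertible_mat (A + ?B')"
      using maximal B' unfolding maximal_open_convex_nonsingular_def maximal_nonsingular_def by blast
    have "A + ?B' \<in> L_I"
      using n carrier[OF A(1)] B' re_form_pos[OF A(1)] B'pos
      by (auto simp: L_I_iff[of _ n] re_form_add[of _ n] intro!: add_pos_pos)
    then show False using A(2) L_I_invertible by blast
  qed
  have "openin (mat_topology n) S"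
    using maximal by (simp add: maximal_open_convex_nonsingular_def)
  then obtain d where d: "0 < d"
    "\<And>C. C \<in> carrier_mat n n \<Longrightarrow> entries_near n d (1\<^sub>m n) C \<Longrightarrow> C \<in> S"
    using openin_mat_topology_imp_near one by blast
  \<comment> \<open>For \<open>C = (B - A) / e\<close> the difference from the identity is
    \<open>(?B' - A) / e\<close>. The factor \<open>e\<close> in the radius thus puts
    \<open>C\<close> within \<open>d\<close> of the identity, and
    \<open>B = A + e C\<close>.\<close>
  obtain A where A: "A \<in> S" "entries_near n (e * d) ?B' A"
    using closure mult_pos_pos[OF e(1) d(1)] unfolding in_closure_of_mat_topology by blast
  note Ac = carrier[OF A(1)]
  define C where "C = complex_of_real (1 / e) \<cdot>\<^sub>m (B - A)"
  have Cc: "C \<in> carrier_mat n n" using B Ac by (auto simp: C_def)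
  have "cmod (C $$ (i, j) - 1\<^sub>m n $$ (i, j)) < d" if ij: "i < n" "j < n" for i j
  proof -
    have "C $$ (i, j) - 1\<^sub>m n $$ (i, j) = (?B' $$ (i, j) - A $$ (i, j)) / of_real e"
      using ij B Ac e by (auto simp: C_def field_simps)
    then have "cmod (C $$ (i, j) - 1\<^sub>m n $$ (i, j)) = cmod (A $$ (i, j) - ?B' $$ (i, j)) / e"
      using e by (simp add: norm_divide norm_minus_commute)
    also have "\<dots> < d" using A(2) ij e by (simp add: entries_near_def field_simps)
    finally show ?thesis .
  qed
  then have "C \<in> S" using Cc by (intro d) (auto simp: entries_near_def)
  then have "A + complex_of_real e \<cdot>\<^sub>m C \<in> S" using A(1) e by (intro add smult)
  moreover have "A + complex_of_real e \<cdot>\<^sub>m C = B"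
    using Ac B e by (intro eq_matI) (auto simp: C_def)
  ultimately show "B \<in> S" by simp
qed

lemma eq_L_I: "S = of_size L_I n"
  using subset_L_I L_I_subset by (rule antisym)

end

lemma of_size_L_I_add_adjoint:
  assumes "1 \<le> n"
  shows "{A \<in> carrier_mat n n. A + mat_adjoint A \<in> pd_mats n} = of_size L_I n"
  using assms by (auto simp: of_size_L_I add_adjoint_pd_iff)

section \<open>The closed family\<close>

lemma closedin_L_I_bar:
  assumes n: "1 \<le> n"
  shows "closedin (mat_topology n) (of_size L_I_bar n)"
  unfolding closedin_def
proof
  show "of_size L_I_bar n \<subseteq> topspace (mat_topology n)" by (auto simp: of_size_def)
  show "openin (mat_topology n) (topspace (mat_topology n) - of_size L_I_bar n)"
  proof (rule openin_mat_topologyI)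
    fix A assume "A \<in> topspace (mat_topology n) - of_size L_I_bar n"
    then obtain x where A: "A \<in> carrier_mat n n" and x: "x \<in> carrier_vec n" and neg: "re_form A x < 0"
      by (auto simp: of_size_L_I_bar[OF n] not_le)
    define m where "m = n * Re (x \<bullet>c x)"
    have m: "0 \<le> m" by (simp add: m_def)
    \<comment> \<open>The form at \<open>x\<close> moves by at most \<open>e * m\<close>; the added
      1 keeps this strictly below \<open>- re_form A x\<close> and the denominator nonzero.\<close>
    define e where "e = - re_form A x / (m + 1)"
    have e: "0 < e" using neg m by (simp add: e_def divide_neg_pos)
    have em: "e * (m + 1) = - re_form A x" using m by (simp add: e_def)
    have "B \<in> topspace (mat_topology n) - of_size L_I_bar n"
      if B: "B \<in> carrier_mat n n" "entries_near n e A B" for B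
    proof -
      have "\<bar>re_form B x - re_form A x\<bar> \<le> e * m"
        using re_form_near[OF A B(1) x B(2)] by (simp add: m_def mult.assoc)
      then have "re_form B x < 0" using em e by (simp add: algebra_simps)
      then show ?thesis using B(1) x by (force simp: of_size_L_I_bar[OF n])
    qed
    then show "\<exists>e>0. \<forall>B\<in>carrier_mat n n. entries_near n e A B \<longrightarrow>
        B \<in> topspace (mat_topology n) - of_size L_I_bar n"
      using e by blast
  qed auto
qed

lemma one_L_I_bar: "1 \<le> n \<Longrightarrow> 1\<^sub>m n \<in> L_I_bar"
  by (auto simp: L_I_bar_iff[OF one_carrier_mat])

lemma re_form_imaginary_unit:
  assumes "x \<in> carrier_vec n"
  shows "re_form (\<i> \<cdot>\<^sub>m 1\<^sub>m n) x = 0"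
  using assms by (simp add: smult_one_mult_vec cscalar_prod_smult_left[of _ n] cscalar_prod_self)

text \<open>The form vanishes identically at this matrix, so subtracting an arbitrarily small
  positive multiple of the identity makes it negative.\<close>

lemma imaginary_unit_frontier:
  assumes n: "1 \<le> n"
  shows "\<i> \<cdot>\<^sub>m 1\<^sub>m n \<in> L_I_bar" "\<i> \<cdot>\<^sub>m 1\<^sub>m n \<in> mat_topology n frontier_of (of_size L_I_bar n)"
proof -
  let ?J = "\<i> \<cdot>\<^sub>m 1\<^sub>m n :: complex mat"
  have J: "?J \<in> carrier_mat n n" by simp
  show in_L: "?J \<in> L_I_bar"
    using n by (simp add: L_I_bar_iff[OF J] re_form_imaginary_unit)
  have "?J \<in> mat_topology n closure_of of_size L_I_bar n"
    unfolding in_closure_of_mat_topology of_size_def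
    using in_L J entries_near_refl by (intro conjI allI impI bexI[of _ ?J]) auto
  moreover have "?J \<notin> mat_topology n interior_of of_size L_I_bar n"
  proof
    assume "?J \<in> mat_topology n interior_of of_size L_I_bar n"
    then obtain e where e: "0 < e" "\<And>B. B \<in> carrier_mat n n \<Longrightarrow> entries_near n e ?J B \<Longrightarrow>
        B \<in> mat_topology n interior_of of_size L_I_bar n"
      using openin_mat_topology_imp_near[OF openin_interior_of] by blast
    let ?B = "?J + complex_of_real (- (e / 2)) \<cdot>\<^sub>m 1\<^sub>m n"
    have "entries_near n e ?J ?B" using e J by (intro entries_near_add_smult_one) auto
    then have "?B \<in> of_size L_I_bar n"
      using e(2)[of ?B] interior_of_subset by fastforce
    then have "0 \<le> re_form ?B (unit_vec n 0)" by (simp add: of_size_L_I_bar[OF n])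
    moreover have "re_form ?B (unit_vec n 0) < 0"
      using re_form_add_smult_one[OF J, of "unit_vec n 0" "- (e / 2)"] e n
        Re_cscalar_prod_self_pos[of "unit_vec n 0" n]
        re_form_imaginary_unit[of "unit_vec n 0" n]
      by (simp add: mult_neg_pos)
    ultimately show False by simp
  qed
  ultimately show "?J \<in> mat_topology n frontier_of (of_size L_I_bar n)"
    by (simp add: frontier_of_def)
qed

lemma mat_mult_index_sum:
  assumes "M \<in> carrier_mat m n" "N \<in> carrier_mat n p" "i < m" "j < p"
  shows "(M * N) $$ (i, j) = (\<Sum>k<n. M $$ (i, k) * N $$ (k, j))"
  using assms by (simp add: scalar_prod_def atLeast0LessThan)

section \<open>Convex sets without involutions\<close>

abbreviation real_diag :: "nat \<Rightarrow> (nat \<Rightarrow> real) \<Rightarrow> complex mat" where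
  "real_diag n d \<equiv> mat_diag n (\<lambda>i. complex_of_real (d i))"

lemma skew_hermitianI:
  assumes "K \<in> carrier_mat n n" "\<And>i j. i < n \<Longrightarrow> j < n \<Longrightarrow> cnj (K $$ (j, i)) = - K $$ (i, j)"
  shows "K \<in> skew_hermitian_mats n"
  using assms by (auto simp: skew_hermitian_mats_def intro!: eq_matI)

lemma skew_hermitianD:
  assumes "K \<in> skew_hermitian_mats n"
  shows "K \<in> carrier_mat n n" "\<And>i j. i < n \<Longrightarrow> j < n \<Longrightarrow> cnj (K $$ (j, i)) = - K $$ (i, j)"
proof -
  show K: "K \<in> carrier_mat n n" using assms by (simp add: skew_hermitian_mats_def)
  fix i j assume ij: "i < n" "j < n"
  have "mat_adjoint K $$ (i, j) = (- K) $$ (i, j)" using assms by (simp add: skew_hermitian_mats_def)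
  then show "cnj (K $$ (j, i)) = - K $$ (i, j)" using K ij by simp
qed

text \<open>An arbitrary competitor in the maximality statement; the goal is that its elements have
  no Hermitian part.\<close>

locale convex_without_involution =
  fixes n :: nat and T :: "complex mat set"
  assumes convex: "convex_mats n T"
    and inversion: "closed_under_inversion T"
    and no_involution: "A \<in> T \<Longrightarrow> \<not> involution_mat A"
    and skew: "skew_hermitian_mats n \<subseteq> T"
begin

text \<open>The Hermitian part is frozen at a diagonal matrix while the skew-Hermitian part ranges
  freely. This freedom allows \<open>K\<close> to be chosen anew before each inversion.\<close>

definition full_fibre :: "(nat \<Rightarrow> real) \<Rightarrow> bool" where
  "full_fibre d \<longleftrightarrow> (\<forall>K\<in>skew_hermitian_mats n. real_diag n d + K \<in> T)"

lemma convex_comb: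
  assumes "A \<in> T" "B \<in> T" "0 \<le> t" "t \<le> 1"
  shows "complex_of_real t \<cdot>\<^sub>m A + complex_of_real (1 - t) \<cdot>\<^sub>m B \<in> T"
proof -
  have "t \<in> {0..1}" using assms by simp
  then show ?thesis using convex assms(1,2) unfolding convex_mats_def by blast
qed

lemma inverse_mem:
  assumes "M \<in> T" "M \<in> carrier_mat n n" "N \<in> carrier_mat n n" "M * N = 1\<^sub>m n"
  shows "N \<in> T"
proof -
  have "N * M = 1\<^sub>m n" using assms(2-4) by (rule mat_mult_left_right_inverse)
  then have "inverts_mat M N \<and> inverts_mat N M" using assms by (simp add: inverts_mat_def)
  then show ?thesis using inversion assms(1) by (auto simp: closed_under_inversion_def)
qed

lemma full_fibre_shrink:
  assumes X: "real_diag n d + K \<in> T" and K: "K \<in> skew_hermitian_mats n" and t: "0 < t" "t < 1"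
  shows "full_fibre (\<lambda>i. t * d i)"
  unfolding full_fibre_def
proof
  fix L assume L: "L \<in> skew_hermitian_mats n"
  note Kd = skew_hermitianD[OF K] and Ld = skew_hermitianD[OF L]
  \<comment> \<open>The solution of \<open>t K + (1 - t) M = L\<close>, again skew-Hermitian because
    the coefficients are real.\<close>
  define M where "M = mat n n (\<lambda>ij. (L $$ ij - of_real t * K $$ ij) / of_real (1 - t))"
  have Mc: "M \<in> carrier_mat n n" by (simp add: M_def)
  have "M \<in> skew_hermitian_mats n"
  proof (rule skew_hermitianI)
    fix i j assume "i < n" "j < n"
    then show "cnj (M $$ (j, i)) = - M $$ (i, j)"
      using Kd(2)[of i j] Ld(2)[of i j] by (simp add: M_def minus_divide_left)
  qed (simp add: M_def)
  then have "complex_of_real t \<cdot>\<^sub>m (real_diag n d + K) + complex_of_real (1 - t) \<cdot>\<^sub>m M \<in> T"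
    using skew t by (intro convex_comb X) auto
  moreover have "complex_of_real t \<cdot>\<^sub>m (real_diag n d + K) + complex_of_real (1 - t) \<cdot>\<^sub>m M
      = real_diag n (\<lambda>i. t * d i) + L"
  proof (rule eq_matI)
    fix i j assume "i < dim_row (real_diag n (\<lambda>i. t * d i) + L)"
      "j < dim_col (real_diag n (\<lambda>i. t * d i) + L)"
    then have ij: "i < n" "j < n" using Ld(1) by auto
    have "complex_of_real (1 - t) * M $$ (i, j) = L $$ (i, j) - of_real t * K $$ (i, j)"
      using ij t by (simp add: M_def)
    then show "(complex_of_real t \<cdot>\<^sub>m (real_diag n d + K) + complex_of_real (1 - t) \<cdot>\<^sub>m M) $$ (i, j)
        = (real_diag n (\<lambda>i. t * d i) + L) $$ (i, j)"
      using ij Kd(1) Ld(1) Mc by (auto simp: mat_diag_def distrib_left)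
  qed (use Kd(1) Ld(1) Mc in auto)
  ultimately show "real_diag n (\<lambda>i. t * d i) + L \<in> T" by simp
qed

lemma zero_skew: "0\<^sub>m n n \<in> skew_hermitian_mats n"
  by (rule skew_hermitianI) auto

lemma full_fibre_diag: "full_fibre d \<Longrightarrow> real_diag n d \<in> T"
  unfolding full_fibre_def using zero_skew by (metis mat_diag_dim right_add_zero_mat)

lemma full_fibre_scale:
  assumes "full_fibre d" "0 < t" "t < 1"
  shows "full_fibre (\<lambda>i. t * d i)"
  using assms zero_skew unfolding full_fibre_def[of d] by (blast intro: full_fibre_shrink)

lemma full_fibre_average:
  assumes d: "full_fibre d" and e: "full_fibre e"
  shows "full_fibre (\<lambda>i. (d i + e i) / 2)"
  unfolding full_fibre_def
proof
  fix K assume K: "K \<in> skew_hermitian_mats n"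
  note Kc = skew_hermitianD(1)[OF K]
  have "complex_of_real (1 / 2) \<cdot>\<^sub>m (real_diag n d + K)
      + complex_of_real (1 - 1 / 2) \<cdot>\<^sub>m (real_diag n e + K) \<in> T"
    using d e K by (intro convex_comb) (auto simp: full_fibre_def)
  moreover have "complex_of_real (1 / 2) \<cdot>\<^sub>m (real_diag n d + K)
      + complex_of_real (1 - 1 / 2) \<cdot>\<^sub>m (real_diag n e + K) = real_diag n (\<lambda>i. (d i + e i) / 2) + K"
    using Kc by (intro eq_matI) (auto simp: mat_diag_def field_simps)
  ultimately show "real_diag n (\<lambda>i. (d i + e i) / 2) + K \<in> T" by simp
qed

text \<open>
  On the coordinates \<open>p, q\<close> inversion maps \<open>[[d p, \<i>], [\<i>, 0]]\<close> to \<open>[[0, -\<i>], [-\<i>, d p]]\<close>,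
  which moves the nonzero entry \<open>d p\<close> of the Hermitian part to the position \<open>q\<close>.
\<close>

lemma full_fibre_fill_zero:
  assumes d: "full_fibre d" and p: "p < n" "d p \<noteq> 0" and q: "q < n" "d q = 0"
  obtains d' where "full_fibre d'" "d' q \<noteq> 0" "\<And>k. d k \<noteq> 0 \<Longrightarrow> d' k \<noteq> 0"
proof -
  have pq: "p \<noteq> q" using p q by auto
  define s where "s i = (if i = p then q else if i = q then p else i)" for i
  have s: "s i < n" if "i < n" for i using that p q by (auto simp: s_def)
  \<comment> \<open>The real diagonal of the inverse. Away from \<open>p\<close> and
    \<open>q\<close> it comes from the inverse \<open>(a - \<i>) / (a\<^sup>2 + 1)\<close> of
    \<open>a + \<i>\<close>.\<close>
  define e where "e i = (if i = p then 0 else if i = q then d p else d i / ((d i)\<^sup>2 + 1))" for i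
  \<comment> \<open>\<open>\<i>\<close> times the permutation matrix of the transposition
    \<open>s\<close>. It couples \<open>p\<close> with \<open>q\<close> and adds \<open>\<i>\<close>
    to every other diagonal entry, which makes those entries invertible even where \<open>d\<close>
    vanishes.\<close>
  define K where "K = mat n n (\<lambda>(i, j). if j = s i then \<i> else 0)"
  define L where "L = mat n n (\<lambda>(i, j). if j = s i then
    (if i = p \<or> i = q then - \<i> else - \<i> / of_real ((d i)\<^sup>2 + 1)) else 0)"
  have K: "K \<in> skew_hermitian_mats n"
    by (rule skew_hermitianI) (auto simp: K_def s_def split: if_splits)
  have L: "L \<in> skew_hermitian_mats n"
    by (rule skew_hermitianI) (auto simp: L_def s_def split: if_splits)
  note Kc = skew_hermitianD(1)[OF K] and Lc = skew_hermitianD(1)[OF L]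
  let ?M = "real_diag n d + K" and ?N = "real_diag n e + L"
  have Mc: "?M \<in> carrier_mat n n" and Nc: "?N \<in> carrier_mat n n" using Kc Lc by auto
  have "?M * ?N = 1\<^sub>m n"
  proof (rule eq_matI)
    fix i j assume "i < dim_row (1\<^sub>m n)" "j < dim_col (1\<^sub>m n)"
    then have ij: "i < n" "j < n" by auto
    have "(?M * ?N) $$ (i, j) = (\<Sum>k<n. ?M $$ (i, k) * ?N $$ (k, j))"
      using Mc Nc ij by (rule mat_mult_index_sum)
    \<comment> \<open>Row \<open>i\<close> of \<open>?M\<close> is supported on \<open>i\<close> and
      \<open>s i\<close>. Two separate summands also cover \<open>s i = i\<close>, where the
      contributions add up.\<close>
    also have "\<dots> = (\<Sum>k<n. (if k = i then of_real (d i) * ?N $$ (i, j) else 0)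
        + (if k = s i then \<i> * ?N $$ (s i, j) else 0))"
      using ij Kc by (intro sum.cong) (auto simp: mat_diag_def K_def algebra_simps)
    also have "\<dots> = of_real (d i) * ?N $$ (i, j) + \<i> * ?N $$ (s i, j)"
      using ij s[OF ij(1)] by (simp add: sum.distrib)
    also have "\<dots> = 1\<^sub>m n $$ (i, j)"
    proof (cases "i = p \<or> i = q")
      case True
      then show ?thesis
        using ij p q pq by (auto simp: mat_diag_def L_def e_def s_def)
    next
      case False
      have nz: "(complex_of_real (d i))\<^sup>2 + 1 \<noteq> 0"
      proof -
        have "complex_of_real ((d i)\<^sup>2 + 1) \<noteq> 0"
          unfolding of_real_eq_0_iff using zero_le_power2[of "d i"] by linarith
        then show ?thesis by simp
      qed
      show ?thesis
        using False ij nz by (auto simp: mat_diag_def L_def e_def s_def field_simps power2_eq_square)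
    qed
    finally show "(?M * ?N) $$ (i, j) = 1\<^sub>m n $$ (i, j)" .
  qed (use Mc Nc in auto)
  moreover have "?M \<in> T" using d K by (simp add: full_fibre_def)
  ultimately have "?N \<in> T" using Mc Nc inverse_mem by blast
  then have "full_fibre (\<lambda>i. 1 / 2 * e i)" by (rule full_fibre_shrink) (use L in auto)
  \<comment> \<open>Averaging with \<open>d\<close> retains the old nonzero entries:
    \<open>e p\<close> is zero, and at every other nonzero entry of \<open>d\<close> the new value
    has the same sign, so nothing cancels.\<close>
  from full_fibre_average[OF d this] have "full_fibre (\<lambda>i. (d i + 1 / 2 * e i) / 2)" .
  moreover have "(d q + 1 / 2 * e q) / 2 \<noteq> 0" using p q pq by (simp add: e_def)
  moreover have "(d k + 1 / 2 * e k) / 2 \<noteq> 0" if k: "d k \<noteq> 0" for k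
  proof (cases "k = p")
    case True
    then show ?thesis using p by (simp add: e_def)
  next
    case False
    have pos: "0 < (d k)\<^sup>2 + 1" using zero_le_power2[of "d k"] by linarith
    have "a + 1 / 2 * (a / b) = a * (1 + 1 / (2 * b))" for a b :: real
      by (simp add: distrib_left mult.commute)
    moreover have "e k = d k / ((d k)\<^sup>2 + 1)" using False q k by (auto simp: e_def)
    ultimately have "d k + 1 / 2 * e k = d k * (1 + 1 / (2 * ((d k)\<^sup>2 + 1)))"
      by (simp only:)
    moreover have "0 < 1 + 1 / (2 * ((d k)\<^sup>2 + 1))" using pos by (intro add_pos_pos) auto
    ultimately show ?thesis using k by simp
  qed
  ultimately show ?thesis by (rule that)
qed

text \<open>Each filling step keeps the nonzero entries, among them the source \<open>p\<close>, and
  strictly shrinks the set of zeros below \<open>n\<close>.\<close>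

lemma full_fibre_nonzero:
  assumes "full_fibre d" "p < n" "d p \<noteq> 0"
  shows "\<exists>d'. full_fibre d' \<and> (\<forall>k<n. d' k \<noteq> 0)"
  using assms
proof (induction "card {k. k < n \<and> d k = 0}" arbitrary: d rule: less_induct)
  case less
  show ?case
  proof (cases "\<forall>k<n. d k \<noteq> 0")
    case True
    then show ?thesis using less.prems by blast
  next
    case False
    then obtain q where q: "q < n" "d q = 0" by blast
    obtain d' where d': "full_fibre d'" "d' q \<noteq> 0" "\<And>k. d k \<noteq> 0 \<Longrightarrow> d' k \<noteq> 0"
      using full_fibre_fill_zero[OF less.prems q] by blast
    have "{k. k < n \<and> d' k = 0} \<subset> {k. k < n \<and> d k = 0}" using d' q by blast
    then have "card {k. k < n \<and> d' k = 0} < card {k. k < n \<and> d k = 0}"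
      by (intro psubset_card_mono) auto
    then show ?thesis using less.hyps d' less.prems by blast
  qed
qed

text \<open>
  If \<open>0 < |h| \<le> 1/2\<close> and \<open>g\<^sup>2 = |h|/2 - h\<^sup>2\<close>, then \<open>1 / (h + \<i> g)\<close> has the real part \<open>2 sgn h\<close>; hence
  inverting a small diagonal matrix with a suitable skew-Hermitian part produces an involution.
\<close>

lemma full_fibre_nonzero_False:
  assumes d: "full_fibre d" and nz: "\<And>k. k < n \<Longrightarrow> d k \<noteq> 0"
  shows False
proof -
  \<comment> \<open>\<open>1 + (\<Sum>k<n. \<bar>d k\<bar>)\<close> bounds every
    \<open>\<bar>d k\<bar>\<close>, so scaling by \<open>\<epsilon>\<close> brings all of them to at
    most 1/2. The summand 1 also ensures \<open>\<epsilon> < 1\<close>, as scaling requires.\<close>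
  define \<epsilon> where "\<epsilon> = 1 / (2 * (1 + (\<Sum>k<n. \<bar>d k\<bar>)))"
  have sum0: "0 \<le> (\<Sum>k<n. \<bar>d k\<bar>)" by (intro sum_nonneg) auto
  have \<epsilon>: "0 < \<epsilon>" "\<epsilon> < 1"
  proof -
    have "1 < 2 * (1 + \<sigma>)" if "0 \<le> \<sigma>" for \<sigma> :: real using that by simp
    from this[OF sum0] have "1 < 2 * (1 + (\<Sum>k<n. \<bar>d k\<bar>))" .
    then show "0 < \<epsilon>" "\<epsilon> < 1" unfolding \<epsilon>_def by (auto simp only: zero_less_divide_1_iff divide_less_eq_1)
  qed
  define h where "h k = \<epsilon> * d k" for k
  have h: "full_fibre h" unfolding h_def using d \<epsilon> by (rule full_fibre_scale)
  have h0: "h k \<noteq> 0" if "k < n" for k using nz[OF that] \<epsilon> by (simp add: h_def)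
  have h_le: "\<bar>h k\<bar> \<le> 1 / 2" if "k < n" for k
  proof -
    have "\<bar>d k\<bar> \<le> (\<Sum>k<n. \<bar>d k\<bar>)" using that by (intro member_le_sum) auto
    then have "\<epsilon> * \<bar>d k\<bar> \<le> \<epsilon> * (1 + (\<Sum>k<n. \<bar>d k\<bar>))" using \<epsilon> by (intro mult_left_mono) auto
    also have "\<dots> = 1 / 2"
    proof -
      have "1 / (2 * (1 + \<sigma>)) * (1 + \<sigma>) = 1 / 2" if "0 \<le> \<sigma>" for \<sigma> :: real
        using that by (simp add: field_simps)
      from this[OF sum0] show ?thesis unfolding \<epsilon>_def .
    qed
    finally show ?thesis using \<epsilon> by (simp add: h_def abs_mult)
  qed
  define g where "g k = sqrt (\<bar>h k\<bar> / 2 - (h k)\<^sup>2)" for k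
  have g: "(h k)\<^sup>2 + (g k)\<^sup>2 = \<bar>h k\<bar> / 2" if "k < n" for k
  proof -
    have "\<bar>h k\<bar> * \<bar>h k\<bar> \<le> \<bar>h k\<bar> * (1 / 2)" using h_le[OF that] by (intro mult_left_mono) auto
    then have "0 \<le> \<bar>h k\<bar> / 2 - (h k)\<^sup>2" by (simp add: power2_eq_square)
    then show ?thesis by (simp add: g_def)
  qed
  define K where "K = mat_diag n (\<lambda>k. \<i> * of_real (g k))"
  \<comment> \<open>The imaginary part of the inverse of \<open>h + \<i> g\<close> is
    \<open>- g / (h\<^sup>2 + g\<^sup>2)\<close>, and the choice of \<open>g\<close> makes the
    denominator \<open>\<bar>h\<bar> / 2\<close>.\<close>
  define L where "L = mat_diag n (\<lambda>k. - \<i> * of_real (2 * g k / \<bar>h k\<bar>))"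
  have K: "K \<in> skew_hermitian_mats n" and L: "L \<in> skew_hermitian_mats n"
    by (rule skew_hermitianI; auto simp: K_def L_def mat_diag_def)+
  have "real_diag n h + K = mat_diag n (\<lambda>k. of_real (h k) + \<i> * of_real (g k))"
    by (intro eq_matI) (auto simp: K_def mat_diag_def)
  moreover have "real_diag n (\<lambda>k. 2 * sgn (h k)) + L
      = mat_diag n (\<lambda>k. of_real (2 * sgn (h k)) - \<i> * of_real (2 * g k / \<bar>h k\<bar>))"
    by (intro eq_matI) (auto simp: L_def mat_diag_def)
  moreover have "(of_real (h k) + \<i> * of_real (g k))
      * (of_real (2 * sgn (h k)) - \<i> * of_real (2 * g k / \<bar>h k\<bar>)) = 1" if k: "k < n" for k
  proof -
    have sgn: "sgn (h k) = h k / \<bar>h k\<bar>" by (simp add: sgn_if)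
    have "h k * (2 * sgn (h k)) + g k * (2 * g k / \<bar>h k\<bar>) = 2 * ((h k)\<^sup>2 + (g k)\<^sup>2) / \<bar>h k\<bar>"
      unfolding sgn by (simp add: power2_eq_square add_divide_distrib distrib_left mult_ac)
    also have "\<dots> = 1" unfolding g[OF k] using h0[OF k] by simp
    finally have "h k * (2 * sgn (h k)) + g k * (2 * g k / \<bar>h k\<bar>) = 1" .
    moreover have "g k * (2 * sgn (h k)) - h k * (2 * g k / \<bar>h k\<bar>) = 0"
      unfolding sgn by simp
    ultimately show ?thesis by (simp add: complex_eq_iff)
  qed
  then have "mat_diag n (\<lambda>k. (of_real (h k) + \<i> * of_real (g k))
      * (of_real (2 * sgn (h k)) - \<i> * of_real (2 * g k / \<bar>h k\<bar>))) = 1\<^sub>m n"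
    by (intro eq_matI) (auto simp: mat_diag_def)
  ultimately have "(real_diag n h + K) * (real_diag n (\<lambda>k. 2 * sgn (h k)) + L) = 1\<^sub>m n"
    by (simp only: mat_diag_diag)
  moreover have "real_diag n h + K \<in> T" using h K by (simp add: full_fibre_def)
  moreover have "real_diag n h + K \<in> carrier_mat n n"
    "real_diag n (\<lambda>k. 2 * sgn (h k)) + L \<in> carrier_mat n n"
    by (rule add_carrier_mat skew_hermitianD(1) K L)+
  ultimately have "real_diag n (\<lambda>k. 2 * sgn (h k)) + L \<in> T"
    using inverse_mem[of "real_diag n h + K"] by blast
  \<comment> \<open>Halving reduces the real parts to exactly \<open>sgn (h k)\<close> and at the
    same time makes the skew-Hermitian part free, so that it can be taken as zero.\<close>
  then have "full_fibre (\<lambda>k. 1 / 2 * (2 * sgn (h k)))"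
    by (rule full_fibre_shrink) (use L in auto)
  then have "real_diag n (\<lambda>k. 1 / 2 * (2 * sgn (h k))) \<in> T" by (rule full_fibre_diag)
  moreover have "involution_mat (real_diag n (\<lambda>k. 1 / 2 * (2 * sgn (h k))))"
  proof -
    have "complex_of_real (1 / 2 * (2 * sgn (h k))) * complex_of_real (1 / 2 * (2 * sgn (h k))) = 1"
      if "k < n" for k
      using h0[OF that] by (simp add: sgn_if)
    then have "mat_diag n (\<lambda>k. complex_of_real (1 / 2 * (2 * sgn (h k)))
        * complex_of_real (1 / 2 * (2 * sgn (h k)))) = 1\<^sub>m n"
      by (intro eq_matI) (auto simp: mat_diag_def)
    then have sq: "real_diag n (\<lambda>k. 1 / 2 * (2 * sgn (h k)))
        * real_diag n (\<lambda>k. 1 / 2 * (2 * sgn (h k))) = 1\<^sub>m n"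
      unfolding mat_diag_diag .
    show ?thesis
      unfolding involution_mat_def square_mat.simps sq carrier_matD[OF mat_diag_dim] by simp
  qed
  ultimately show False using no_involution by blast
qed

lemma hermitian_part_zero:
  assumes X: "real_diag n d + K \<in> T" and K: "K \<in> skew_hermitian_mats n" and p: "p < n"
  shows "d p = 0"
proof (rule ccontr)
  assume "d p \<noteq> 0"
  moreover have "full_fibre (\<lambda>i. 1 / 2 * d i)" using X K by (rule full_fibre_shrink) auto
  ultimately have "\<exists>d'. full_fibre d' \<and> (\<forall>k<n. d' k \<noteq> 0)"
    using p by (intro full_fibre_nonzero[of "\<lambda>i. 1 / 2 * d i" p]) auto
  then show False using full_fibre_nonzero_False by blast
qed

end

text \<open>Unitary similarity respects convex combinations, products, the identity and
  skew-Hermitian matrices. The Hermitian part of a given element may therefore be assumed diagonal,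
  at the price of replacing \<open>T\<close>.\<close>

lemma (in convex_without_involution) unitary_conjugate:
  assumes U: "U \<in> unitary_mats n"
  shows "convex_without_involution n {X \<in> carrier_mat n n. U * X * mat_adjoint U \<in> T}"
proof
  note Uu = unitary_matsD[OF U]
  have Ua: "mat_adjoint U \<in> carrier_mat n n" using Uu(1) by auto
  let ?C = "\<lambda>X. U * X * mat_adjoint U"
  have UX: "U * X \<in> carrier_mat n n" and Cc: "?C X \<in> carrier_mat n n"
    if "X \<in> carrier_mat n n" for X
    using Uu(1) Ua that by auto
  have Cmult: "?C X * ?C Y = ?C (X * Y)"
    if X: "X \<in> carrier_mat n n" and Y: "Y \<in> carrier_mat n n" for X Y
  proof -
    have "?C X * ?C Y = U * X * mat_adjoint U * (U * (Y * mat_adjoint U))"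
      using assoc_mult_mat[OF Uu(1) Y Ua] by simp
    also have "\<dots> = U * X * (Y * mat_adjoint U)"
      using UX[OF X] Ua Uu(1) mult_carrier_mat[OF Y Ua] Uu(2) by (rule mult_mat_cancel_mid)
    also have "\<dots> = ?C (X * Y)"
      using assoc_mult_mat[OF UX[OF X] Y Ua] assoc_mult_mat[OF Uu(1) X Y] by simp
    finally show ?thesis .
  qed
  have C1: "?C (1\<^sub>m n) = 1\<^sub>m n" using Uu by simp
  let ?T' = "{X \<in> carrier_mat n n. ?C X \<in> T}"
  show "convex_mats n ?T'"
    unfolding convex_mats_def
  proof (intro conjI ballI)
    fix A B t assume A: "A \<in> ?T'" and B: "B \<in> ?T'" and t: "t \<in> {0..1::real}"
    then have c: "A \<in> carrier_mat n n" "B \<in> carrier_mat n n" by auto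
    let ?S = "complex_of_real t \<cdot>\<^sub>m A + complex_of_real (1 - t) \<cdot>\<^sub>m B"
    have "?C ?S = complex_of_real t \<cdot>\<^sub>m ?C A + complex_of_real (1 - t) \<cdot>\<^sub>m ?C B"
      using c Uu(1) Ua UX
      by (simp add: mult_add_distrib_mat[of _ n n _ n] add_mult_distrib_mat[of _ n n _ _ n]
          mult_smult_distrib[of _ n n _ n] mult_smult_assoc_mat[of _ n n _ n])
    then show "?S \<in> ?T'" using A B c t convex_comb by auto
  qed auto
  show "closed_under_inversion ?T'"
    unfolding closed_under_inversion_def
  proof (intro ballI allI impI)
    fix M N assume M: "M \<in> ?T'" and "inverts_mat M N \<and> inverts_mat N M"
    then have Mc: "M \<in> carrier_mat n n" and inv: "inverts_mat M N" "inverts_mat N M" by auto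
    note N = inverts_mat_carrier[OF Mc inv]
    have "?C N \<in> T"
    proof (rule inverse_mem)
      show "?C M \<in> T" using M by simp
      show "?C M * ?C N = 1\<^sub>m n" unfolding Cmult[OF Mc N(1)] N(2) by (rule C1)
    qed (rule Cc[OF Mc] Cc[OF N(1)])+
    then show "N \<in> ?T'" using N by simp
  qed
  show "\<not> involution_mat A" if "A \<in> ?T'" for A
  proof
    have A: "A \<in> carrier_mat n n" "?C A \<in> T" using that by auto
    assume "involution_mat A"
    then have "A * A = 1\<^sub>m n" using A by (auto simp: involution_mat_def)
    then have "?C A * ?C A = 1\<^sub>m n" using Cmult[OF A(1) A(1)] C1 by simp
    then have "involution_mat (?C A)" using Cc[OF A(1)] unfolding involution_mat_def by auto
    then show False using A(2) no_involution by blast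
  qed
  show "skew_hermitian_mats n \<subseteq> ?T'"
  proof
    fix K assume K: "K \<in> skew_hermitian_mats n"
    then have Kc: "K \<in> carrier_mat n n" by (simp add: skew_hermitian_mats_def)
    have "re_form (?C K) x = 0" if x: "x \<in> carrier_vec n" for x
    proof -
      have "re_form (?C K) x = re_form K (mat_adjoint U *\<^sub>v x)"
        using re_form_congruence[OF Kc Ua x] by simp
      then show ?thesis
        using K skew_hermitian_iff[OF Kc] mult_mat_vec_carrier[OF Ua x] by simp
    qed
    then have "?C K \<in> skew_hermitian_mats n" using skew_hermitian_iff[OF Cc[OF Kc]] by blast
    then show "K \<in> ?T'" using skew Kc by auto
  qed
qed

lemma (in convex_without_involution) subset_skew_hermitian: "T \<subseteq> skew_hermitian_mats n"
proof
  fix A assume A: "A \<in> T"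
  then have Ac: "A \<in> carrier_mat n n" using convex by (auto simp: convex_mats_def)
  let ?H = "A + mat_adjoint A"
  have H: "?H \<in> hermitian_mats n" using Ac by (rule add_adjoint_hermitian)
  then have Hc: "?H \<in> carrier_mat n n" by (simp add: hermitian_mats_def)
  obtain U d where U: "U \<in> unitary_mats n" and d: "mat_adjoint U * ?H * U = real_diag n d"
    using hermitian_diagonalization[OF H] .
  note Uu = unitary_matsD[OF U]
  have Ua: "mat_adjoint U \<in> carrier_mat n n" using Uu(1) by auto
  interpret conj: convex_without_involution n "{X \<in> carrier_mat n n. U * X * mat_adjoint U \<in> T}"
    using U by (rule unitary_conjugate)
  define X where "X = mat_adjoint U * A * U"
  have UA: "mat_adjoint U * A \<in> carrier_mat n n" using Ua Ac by auto
  then have X: "X \<in> carrier_mat n n" using Uu(1) by (auto simp: X_def)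
  have "U * X * mat_adjoint U = A"
  proof -
    have "U * X = U * mat_adjoint U * (A * U)"
      unfolding X_def assoc_mult_mat[OF Ua Ac Uu(1)]
      using assoc_mult_mat[OF Uu(1) Ua mult_carrier_mat[OF Ac Uu(1)]] by simp
    then have "U * X = A * U" using Uu Ac by simp
    then show ?thesis using assoc_mult_mat[OF Ac Uu(1) Ua] Uu(3) Ac by simp
  qed
  then have XT: "X \<in> {X \<in> carrier_mat n n. U * X * mat_adjoint U \<in> T}" using X A by simp
  \<comment> \<open>The matrix \<open>real_diag n d\<close> diagonalizes
    \<open>A + mat_adjoint A\<close>, which is twice the Hermitian part of \<open>A\<close>; hence
    the halves.\<close>
  define K where "K = X - real_diag n (\<lambda>i. d i / 2)"
  have Kc: "K \<in> carrier_mat n n" unfolding K_def by (rule minus_carrier_mat[OF mat_diag_dim])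
  have XK: "real_diag n (\<lambda>i. d i / 2) + K = X"
    using X by (intro eq_matI) (auto simp: K_def mat_diag_def)
  have form: "2 * re_form X x = re_form (real_diag n d) x" if x: "x \<in> carrier_vec n" for x
  proof -
    have "re_form (real_diag n d) x = re_form ?H (U *\<^sub>v x)"
      using re_form_congruence[OF Hc Uu(1) x] d by simp
    also have "\<dots> = 2 * re_form A (U *\<^sub>v x)"
      using mult_mat_vec_carrier[OF Uu(1) x] by (rule re_form_add_adjoint[OF Ac])
    also have "re_form A (U *\<^sub>v x) = re_form X x"
      unfolding X_def using re_form_congruence[OF Ac Uu(1) x] by simp
    finally show ?thesis by simp
  qed
  have "re_form K x = 0" if x: "x \<in> carrier_vec n" for x
  proof -
    have "re_form X x = re_form (real_diag n (\<lambda>i. d i / 2)) x + re_form K x"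
      using re_form_add[OF mat_diag_dim Kc x] XK by metis
    moreover have "re_form (real_diag n (\<lambda>i. d i / 2)) x = re_form (real_diag n d) x / 2"
      unfolding re_form_mat_diag[OF x] by (simp add: sum_divide_distrib)
    ultimately show ?thesis using form[OF x] by simp
  qed
  then have K: "K \<in> skew_hermitian_mats n" using skew_hermitian_iff[OF Kc] by blast
  have d0: "d p = 0" if "p < n" for p
    using conj.hermitian_part_zero[OF _ K that, of "\<lambda>i. d i / 2"] XT XK by simp
  have "re_form A x = 0" if x: "x \<in> carrier_vec n" for x
  proof -
    let ?y = "mat_adjoint U *\<^sub>v x"
    have y: "?y \<in> carrier_vec n" using Ua x by (rule mult_mat_vec_carrier)
    have "re_form (real_diag n d) ?y = 0" unfolding re_form_mat_diag[OF y] using d0 by simp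
    then have "re_form X ?y = 0" using form[OF y] by simp
    moreover have "re_form X ?y = re_form A (U *\<^sub>v ?y)"
      unfolding X_def by (rule re_form_congruence[OF Ac Uu(1) y])
    moreover have "U *\<^sub>v ?y = x"
      using assoc_mult_mat_vec[OF Uu(1) Ua x] Uu(3) x by simp
    ultimately show ?thesis by simp
  qed
  then show "A \<in> skew_hermitian_mats n" using skew_hermitian_iff[OF Ac] by blast
qed

text \<open>If \<open>K\<close> squares to the identity, the squared norm of \<open>x\<close> equals
  minus the squared norm of \<open>K *\<^sub>v x\<close>, which is impossible for a unit
  vector.\<close>

lemma skew_hermitian_not_involution:
  assumes n: "1 \<le> n" and K: "K \<in> skew_hermitian_mats n"
  shows "\<not> involution_mat K"
proof
  have Kc: "K \<in> carrier_mat n n" and Ka: "mat_adjoint K = - K"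
    using K by (auto simp: skew_hermitian_mats_def)
  assume "involution_mat K"
  then have KK: "K * K = 1\<^sub>m n" using Kc by (auto simp: involution_mat_def)
  let ?x = "unit_vec n 0 :: complex vec"
  have x: "?x \<in> carrier_vec n" "?x \<noteq> 0\<^sub>v n" using n by auto
  let ?y = "K *\<^sub>v ?x"
  have y: "?y \<in> carrier_vec n" using Kc x by auto
  have "?x \<bullet>c ?x = (K *\<^sub>v ?y) \<bullet>c ?x"
    using assoc_mult_mat_vec[OF Kc Kc x(1)] KK by simp
  also have "\<dots> = ?y \<bullet>c (- K *\<^sub>v ?x)"
    using cscalar_prod_adjoint[OF Kc y x(1)] Ka by simp
  also have "- K *\<^sub>v ?x = - 1 \<cdot>\<^sub>v ?y"
    using Kc x by (intro eq_vecI) auto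
  also have "?y \<bullet>c (- 1 \<cdot>\<^sub>v ?y) = - (?y \<bullet>c ?y)"
    using y by (simp add: conjugate_smult_vec)
  finally have "Re (?x \<bullet>c ?x) = - Re (?y \<bullet>c ?y)" by simp
  then show False
    using Re_cscalar_prod_self_pos[OF x] Re_cscalar_prod_self_nonneg[of ?y] by linarith
qed

lemma convex_skew_hermitian: "convex_mats n (skew_hermitian_mats n)"
  unfolding convex_mats_def
proof (intro conjI ballI)
  show "skew_hermitian_mats n \<subseteq> carrier_mat n n" by (auto simp: skew_hermitian_mats_def)
  fix A B t assume A: "A \<in> skew_hermitian_mats n" and B: "B \<in> skew_hermitian_mats n"
  have c: "A \<in> carrier_mat n n" "B \<in> carrier_mat n n"
    using A B by (auto simp: skew_hermitian_mats_def)
  then have "complex_of_real t \<cdot>\<^sub>m A + complex_of_real (1 - t) \<cdot>\<^sub>m B \<in> carrier_mat n n" by simp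
  then show "complex_of_real t \<cdot>\<^sub>m A + complex_of_real (1 - t) \<cdot>\<^sub>m B \<in> skew_hermitian_mats n"
    using A B c
    by (simp add: skew_hermitian_iff re_form_add[of _ n] re_form_smult[of _ n] del: of_real_diff)
qed

lemma maximal_convex_without_involution_skew_hermitian:
  assumes "1 \<le> n"
  shows "maximal_convex_without_involution n (skew_hermitian_mats n)"
  unfolding maximal_convex_without_involution_def
proof (intro conjI allI impI ballI convex_skew_hermitian)
  show "\<not> involution_mat K" if "K \<in> skew_hermitian_mats n" for K
    using assms that by (rule skew_hermitian_not_involution)
  fix T assume "convex_mats n T" "closed_under_inversion T" "\<forall>A\<in>T. \<not> involution_mat A"
    and sub: "skew_hermitian_mats n \<subseteq> T"
  then interpret convex_without_involution n T by unfold_locales auto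
  show "T = skew_hermitian_mats n" using subset_skew_hermitian sub by (rule antisym)
qed

theorem theorem4p1:
  shows "
    (mat_cone L_I \<and> closed_under_inversion L_I \<and> (\<forall>n\<ge>1. 1\<^sub>m n \<in> L_I) \<and>
     maximal_open_matrix_convex_nonsingular L_I)
  \<and>
    (\<forall>n (S :: complex mat set). 1 \<le> n \<longrightarrow> S \<subseteq> carrier_mat n n \<longrightarrow>
       mat_cone S \<longrightarrow> closed_under_inversion S \<longrightarrow> 1\<^sub>m n \<in> S \<longrightarrow>
       maximal_open_convex_nonsingular n S \<longrightarrow>
       (\<forall>A\<in>S. \<forall>U\<in>unitary_mats n. mat_adjoint U * A * U \<in> S) \<longrightarrow>
       S = {A \<in> carrier_mat n n. A + mat_adjoint A \<in> pd_mats n} \<and>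
       S = of_size L_I n)
  \<and>
    (mat_cone L_I_bar \<and> closed_under_inversion L_I_bar \<and>
     matrix_convex L_I_bar \<and>
     (\<forall>n\<ge>1. closedin (mat_topology n) (of_size L_I_bar n)) \<and>
     (\<forall>n\<ge>1. 1\<^sub>m n \<in> L_I_bar) \<and>
     (\<forall>n\<ge>1. \<i> \<cdot>\<^sub>m 1\<^sub>m n \<in> L_I_bar \<and>
       \<i> \<cdot>\<^sub>m 1\<^sub>m n \<in> mat_topology n frontier_of (of_size L_I_bar n)))
  \<and>
    (L_I_bar \<inter> L_minus_I_bar = all_sizes skew_hermitian_mats \<and>
     matrix_convex_cone (all_sizes skew_hermitian_mats) \<and>
     closed_under_inversion (all_sizes skew_hermitian_mats) \<and>
     (\<forall>n\<ge>1. maximal_convex_without_involution n (skew_hermitian_mats n)))"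
proof (intro conjI)
  show "mat_cone L_I" "closed_under_inversion L_I" "\<forall>n\<ge>1. 1\<^sub>m n \<in> L_I"
    using mat_cone_L_I closed_under_inversion_L_I one_L_I by auto
  show "maximal_open_matrix_convex_nonsingular L_I"
    unfolding maximal_open_matrix_convex_nonsingular_def
    using matrix_convex_L_I L_I_invertible openin_L_I maximal_nonsingular_L_I by blast
  show "\<forall>n (S :: complex mat set). 1 \<le> n \<longrightarrow> S \<subseteq> carrier_mat n n \<longrightarrow>
       mat_cone S \<longrightarrow> closed_under_inversion S \<longrightarrow> 1\<^sub>m n \<in> S \<longrightarrow>
       maximal_open_convex_nonsingular n S \<longrightarrow>
       (\<forall>A\<in>S. \<forall>U\<in>unitary_mats n. mat_adjoint U * A * U \<in> S) \<longrightarrow>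
       S = {A \<in> carrier_mat n n. A + mat_adjoint A \<in> pd_mats n} \<and>
       S = of_size L_I n"
  proof (intro allI impI)
    fix n and S :: "complex mat set"
    assume n: "1 \<le> n" and "mat_cone S" "closed_under_inversion S" "1\<^sub>m n \<in> S"
      "maximal_open_convex_nonsingular n S"
      "\<forall>A\<in>S. \<forall>U\<in>unitary_mats n. mat_adjoint U * A * U \<in> S"
    then interpret unitary_invariant_cone n S by unfold_locales auto
    show "S = {A \<in> carrier_mat n n. A + mat_adjoint A \<in> pd_mats n} \<and> S = of_size L_I n"
      unfolding of_size_L_I_add_adjoint[OF n] using eq_L_I by blast
  qed
  show "mat_cone L_I_bar" "closed_under_inversion L_I_bar" "matrix_convex L_I_bar"
    using mat_cone_L_I_bar closed_under_inversion_L_I_bar matrix_convex_L_I_bar by auto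
  show "\<forall>n\<ge>1. closedin (mat_topology n) (of_size L_I_bar n)" "\<forall>n\<ge>1. 1\<^sub>m n \<in> L_I_bar"
    using closedin_L_I_bar one_L_I_bar by auto
  show "\<forall>n\<ge>1. \<i> \<cdot>\<^sub>m 1\<^sub>m n \<in> L_I_bar \<and>
       \<i> \<cdot>\<^sub>m 1\<^sub>m n \<in> mat_topology n frontier_of (of_size L_I_bar n)"
    using imaginary_unit_frontier by blast
  show "L_I_bar \<inter> L_minus_I_bar = all_sizes skew_hermitian_mats"
    by (rule L_I_bar_inter_L_minus_I_bar)
  show "matrix_convex_cone (all_sizes skew_hermitian_mats)"
    by (rule matrix_convex_cone_skew_hermitian)
  show "closed_under_inversion (all_sizes skew_hermitian_mats)"
    by (rule closed_under_inversion_skew_hermitian)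
  show "\<forall>n\<ge>1. maximal_convex_without_involution n (skew_hermitian_mats n)"
    using maximal_convex_without_involution_skew_hermitian by blast
qed

end
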